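(* There is no universal $K_\sigma$ subgroup of $H_+([0,1])$. That is, there is no $K_\sigma$ subgroup $L \subseteq H_+([0,1])$ such that for every $K_\sigma$ subgroup $H \subseteq H_+([0,1])$ there exists a continuous group homomorphism $\varphi : H_+([0,1]) \to H_+([0,1])$ with $H = \varphi^{-1}[L]$.
   Context: $H_+([0,1])$ denotes the group, under composition, of increasing homeomorphisms of the unit interval $[0,1]$; it is a Polish group with the topology of uniform convergence (which coincides on it with the topology of pointwise convergence). A subset of a topological space is $K_\sigma$ if it is a countable union of compact sets. For subgroups $H, L$ of a Polish group $G$, $H$ is group homomorphism reducible to $L$ (written $H \leq_{\mathrm g} L$) iff there is a continuous group homomorphism $\varphi : G \to G$ with $H = \varphi^{-1}[L]$. A universal $K_\sigma$ subgroup of $G$ is a $K_\sigma$ subgroup $L$ of $G$ such that $H \leq_{\mathrm g} L$ for every $K_\sigma$ subgroup $H$ of $G$. *)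

theory Defs
  imports "HOL-Analysis.Analysis" "HOL-Algebra.Bij"
begin

text \<open>As in \<^theory>\<open>HOL-Algebra.Bij\<close>, a self-map of the unit interval is represented by a
  function on the reals that is \<^const>\<open>extensional\<close> on \<open>{0..1}\<close>, so that equal maps are equal
  as HOL functions.\<close>

definition Hplus_carrier :: "(real \<Rightarrow> real) set" where
  "Hplus_carrier =
    {f \<in> extensional {0..1}. (\<exists>g. homeomorphism {0..1} {0..1} f g) \<and> strict_mono_on {0..1} f}"

definition Hplus :: "(real \<Rightarrow> real) monoid" where
  "Hplus = (BijGroup {0..1}) \<lparr>carrier := Hplus_carrier\<rparr>"

text \<open>Uniform convergence: \<^const>\<open>cfunspace\<close> carries the supremum metric, see
  \<open>Hplus_dist\<close> below.\<close>

definition Hplus_topology :: "(real \<Rightarrow> real) topology" where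
  "Hplus_topology =
    subtopology (mtopology_of (cfunspace (top_of_set {0..1}) euclidean_metric)) Hplus_carrier"

definition K_sigma_in :: "'a topology \<Rightarrow> 'a set \<Rightarrow> bool" where
  "K_sigma_in X = countable union_of compactin X"

text \<open>In the next two definitions \<open>X\<close> is the topology of the group \<open>G\<close>.\<close>

definition group_hom_reducible ::
    "('a, 'b) monoid_scheme \<Rightarrow> 'a topology \<Rightarrow> 'a set \<Rightarrow> 'a set \<Rightarrow> bool" where
  "group_hom_reducible G X H L \<longleftrightarrow>
    (\<exists>\<phi> \<in> hom G G. continuous_map X X \<phi> \<and> H = {x \<in> carrier G. \<phi> x \<in> L})"

definition universal_K_sigma_subgroup ::
    "('a, 'b) monoid_scheme \<Rightarrow> 'a topology \<Rightarrow> 'a set \<Rightarrow> bool" where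
  "universal_K_sigma_subgroup G X L \<longleftrightarrow>
    subgroup L G \<and> K_sigma_in X L \<and>
    (\<forall>H. subgroup H G \<and> K_sigma_in X H \<longrightarrow> group_hom_reducible G X H L)"

lemma carrier_Hplus [simp]: "carrier Hplus = Hplus_carrier"
  by (simp add: Hplus_def)

lemma Hplus_carrier_subset_Bij: "Hplus_carrier \<subseteq> Bij {0..1}"
proof
  fix f assume f: "f \<in> Hplus_carrier"
  then have "f ` {0..1} = {0..1}" "inj_on f {0..1}"
    by (auto simp only: Hplus_carrier_def homeomorphism_def mem_Collect_eq
        intro: strict_mono_on_imp_inj_on)
  then show "f \<in> Bij {0..1}"
    using f by (simp add: Bij_def bij_betw_def Hplus_carrier_def)
qed

lemma mult_Hplus:
  "\<lbrakk>f \<in> Hplus_carrier; g \<in> Hplus_carrier\<rbrakk> \<Longrightarrow> f \<otimes>\<^bsub>Hplus\<^esub> g = compose {0..1} f g"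
  using Hplus_carrier_subset_Bij by (auto simp: Hplus_def BijGroup_def)

lemma one_Hplus: "\<one>\<^bsub>Hplus\<^esub> = (\<lambda>x\<in>{0..1}. x)"
  by (simp add: Hplus_def BijGroup_def)

lemma subgroup_Hplus: "subgroup Hplus_carrier (BijGroup {0..1})"
proof (rule subgroup.intro)
  show "Hplus_carrier \<subseteq> carrier (BijGroup {0..1})"
    using Hplus_carrier_subset_Bij by (simp add: BijGroup_def)
next
  fix f g assume f: "f \<in> Hplus_carrier" and g: "g \<in> Hplus_carrier"
  obtain f' g' where f': "homeomorphism {0..1} {0..1} f f'"
    and g': "homeomorphism {0..1} {0..1} g g'"
    using f g by (auto simp: Hplus_carrier_def)
  have "homeomorphism {0..1} {0..1} (compose {0..1} f g) (g' \<circ> f')"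
    by (rule homeomorphism_cong[OF homeomorphism_compose[OF g' f']]) (auto simp: compose_def)
  moreover have "strict_mono_on {0..1} (compose {0..1} f g)"
  proof (rule strict_mono_onI)
    fix x y :: real assume xy: "x \<in> {0..1}" "y \<in> {0..1}" "x < y"
    have "g x \<in> {0..1}" "g y \<in> {0..1}"
      using xy g' by (auto simp: homeomorphism_def)
    moreover have "g x < g y"
      using xy g by (auto simp: Hplus_carrier_def strict_mono_on_def)
    ultimately show "compose {0..1} f g x < compose {0..1} f g y"
      using xy f by (auto simp: Hplus_carrier_def strict_mono_on_def compose_def)
  qed
  ultimately have "compose {0..1} f g \<in> Hplus_carrier"
    by (auto simp: Hplus_carrier_def)
  then show "f \<otimes>\<^bsub>BijGroup {0..1}\<^esub> g \<in> Hplus_carrier"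
    using f g Hplus_carrier_subset_Bij by (auto simp: BijGroup_def)
next
  have "homeomorphism {0..1} {0..1} (\<lambda>x\<in>{0..1::real}. x) (\<lambda>x. x)"
    by (rule homeomorphism_cong[OF homeomorphism_ident]) auto
  then show "\<one>\<^bsub>BijGroup {0..1}\<^esub> \<in> Hplus_carrier"
    by (auto simp: BijGroup_def Hplus_carrier_def strict_mono_on_def)
next
  fix f assume f: "f \<in> Hplus_carrier"
  let ?h = "\<lambda>x\<in>{0..1}. inv_into {0..1} f x"
  obtain g where g: "homeomorphism {0..1} {0..1} f g"
    using f by (auto simp: Hplus_carrier_def)
  have inj: "inj_on f {0..1}"
    using g by (metis homeomorphism_def inj_on_inverseI)
  have h: "?h x = g x" if "x \<in> {0..1}" for x
    using that g inj by (metis homeomorphism_def imageI inv_into_f_f restrict_apply')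
  have "homeomorphism {0..1} {0..1} ?h f"
    by (rule homeomorphism_cong[OF homeomorphism_symD[OF g]]) (use h in auto)
  moreover have "strict_mono_on {0..1} ?h"
  proof (rule strict_mono_onI)
    fix x y :: real assume xy: "x \<in> {0..1}" "y \<in> {0..1}" "x < y"
    have mem: "g x \<in> {0..1}" "g y \<in> {0..1}" and eq: "f (g x) = x" "f (g y) = y"
      using xy g by (auto simp: homeomorphism_def)
    have "g x < g y"
    proof (rule ccontr)
      assume "\<not> g x < g y"
      then have "f (g y) \<le> f (g x)"
        using f mem by (cases "g x = g y") (auto simp: Hplus_carrier_def strict_mono_on_def less_imp_le)
      then show False using eq xy by simp
    qed
    then show "?h x < ?h y" using h xy by simp
  qed
  ultimately have "?h \<in> Hplus_carrier"
    by (auto simp: Hplus_carrier_def)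
  then show "inv\<^bsub>BijGroup {0..1}\<^esub> f \<in> Hplus_carrier"
    using f Hplus_carrier_subset_Bij by (auto simp: inv_BijGroup)
qed

lemma group_Hplus: "group Hplus"
  unfolding Hplus_def by (rule subgroup.subgroup_is_group[OF subgroup_Hplus group_BijGroup])

lemma Hplus_carrier_subset_cfunspace:
  "Hplus_carrier \<subseteq> mspace (cfunspace (top_of_set {0..1}) euclidean_metric)"
proof
  fix f assume f: "f \<in> Hplus_carrier"
  then have "f ` {0..1} = {0..1}" "continuous_on {0..1} f" "f \<in> extensional {0..1}"
    by (auto simp: Hplus_carrier_def homeomorphism_def)
  then show "f \<in> mspace (cfunspace (top_of_set {0..1}) euclidean_metric)"
    by (auto simp: mspace_cfunspace Met_TC.fspace_def Met_TC.mbounded)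
qed

lemma topspace_Hplus_topology [simp]: "topspace Hplus_topology = carrier Hplus"
  unfolding Hplus_topology_def
  using Hplus_carrier_subset_cfunspace by (auto simp del: mspace_cfunspace)

lemma Hplus_dist:
  assumes "f \<in> carrier Hplus" "g \<in> carrier Hplus"
  shows "mdist (cfunspace (top_of_set {0..1}) euclidean_metric) f g
    = (SUP x\<in>{0..1}. \<bar>f x - g x\<bar>)"
proof -
  have "f \<in> Met_TC.fspace {0..1}" "g \<in> Met_TC.fspace {0..1}"
    using assms Hplus_carrier_subset_cfunspace
      cfunspace_subset_funspace[of "top_of_set {0..1::real}" "euclidean_metric :: real metric"]
    by (auto simp del: mspace_cfunspace)
  then show ?thesis
    by (simp add: mdist_cfunspace_eq_mdist_funspace Met_TC.fdist_def dist_real_def)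
qed

end

theory Submission
  imports Defs
begin

text \<open>
  Write \<open>G\<close> for the group of increasing homeomorphisms of \<open>[0,1]\<close>. The proof rests on a rigidity
  property of \<open>G\<close>, which turns the question into one about moduli of continuity, and on a diagonal
  argument against the countably many moduli that a \<open>K\<^sub>\<sigma>\<close> subgroup provides.

  \<^bold>\<open>Rigidity.\<close> Every nontrivial continuous homomorphism \<open>\<phi> : G \<rightarrow> G\<close> contains a copy of the standard
  action: there is a strictly monotone \<open>h : (0,1) \<rightarrow> [0,1]\<close> with \<open>\<phi>(f)(h(y)) = h(f(y))\<close>
  (\<open>equivariant_monotone_map\<close>). To find it, take a point \<open>x\<close> that \<open>\<phi>(G)\<close> moves and, for each
  \<open>b\<close>, the commuting subgroups \<open>A\<close> and \<open>B\<close> of homeomorphisms supported in \<open>(0,b)\<close> and in \<open>(b,1)\<close>.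
  One of them fixes \<open>x\<close> (\<open>fixes_supp_left_or_right\<close>): otherwise orbits being intervals would force
  the orbit of \<open>x\<close> under \<open>A\<close> into its orbit under \<open>B\<close>, so every element of \<open>A\<close> that fixes \<open>x\<close>
  would fix its whole orbit under \<open>A\<close>; but \<open>A\<close> contains elements with disjoint supports that move
  \<open>x\<close> to the same point, and one of them has conjugates that still do so and converge to the
  identity. The threshold \<open>q\<close> between the two alternatives is a point
  whose stabilizer in \<open>G\<close> fixes \<open>x\<close>, so that \<open>\<phi>(f)(x)\<close> depends only on \<open>f(q)\<close>.

  \<^bold>\<open>Moduli.\<close> Let \<open>L\<close> be the union of an increasing sequence of compact sets \<open>K\<^sub>n\<close>. Each \<open>K\<^sub>n\<close> is
  equicontinuous. Suppose \<open>\<phi>\<close> maps into \<open>L\<close> a path of homeomorphisms \<open>slide s\<close> that act as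
  translations near the middle of the interval. By Baire, \<open>\<phi>(slide s)\<close> stays in one \<open>K\<^sub>n\<close> for all
  \<open>s\<close> in some interval. Hence the increments of \<open>h\<close> over short intervals of a fixed length control
  each other with a modulus that depends on \<open>n\<close> alone, whatever \<open>h\<close> is. Since \<open>h\<close> is monotone and
  bounded, some of these increments are small; so all are, and \<open>h\<close> has one of countably many
  moduli of continuity. A similar argument bounds the increments from below. A homeomorphism \<open>g\<close>
  whose graph is steep enough at one point, measured against all of these countably many moduli,
  then cannot satisfy \<open>\<phi>(g) \<in> L\<close> (\<open>not_captured_by_compacts\<close>).

  \<^bold>\<open>Conclusion.\<close> The group \<open>H\<close> generated by the compact set of slides together with such a \<open>g\<close> is
  \<open>K\<^sub>\<sigma>\<close>. All generators fix the point \<open>1/8\<close>, so \<open>H \<noteq> G\<close>, and a homomorphism with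
  \<open>H = \<phi>\<^sup>-\<^sup>1[L]\<close> would have to be nontrivial. Hence \<open>H\<close> is not reducible to \<open>L\<close>.
\<close>

section \<open>The group of increasing homeomorphisms\<close>

interpretation Hp: group Hplus by (rule group_Hplus)

text \<open>Only continuity, strict monotonicity and the two boundary values have to be checked for
  membership: a continuous injection of a compact space is a homeomorphism onto its image, and the
  intermediate value theorem makes it onto.\<close>

lemma Hplus_carrier_iff:
  "f \<in> Hplus_carrier \<longleftrightarrow> f \<in> extensional {0..1} \<and> continuous_on {0..1} f \<and>
     strict_mono_on {0..1} f \<and> f 0 = 0 \<and> f 1 = 1"  (is "?L \<longleftrightarrow> ?R")
proof
  assume f: ?L
  then obtain g where g: "homeomorphism {0..1} {0..1} f g" and mono: "strict_mono_on {0..1} f"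
    by (auto simp: Hplus_carrier_def)
  have im: "f ` {0..1} = {0..1}" using g by (simp add: homeomorphism_def)
  have le: "f x \<le> f y" if "x \<in> {0..1}" "y \<in> {0..1}" "x \<le> y" for x y
    using strict_mono_on_leD[OF mono that] .
  have "0 \<in> f ` {0..1}" "1 \<in> f ` {0..1}" unfolding im by auto
  then obtain x y where x: "x \<in> {0..1}" "f x = 0" and y: "y \<in> {0..1}" "f y = 1"
    by (force simp only: image_iff)
  have "f 0 \<in> f ` {0..1}" "f 1 \<in> f ` {0..1}" by auto
  then have "f 0 \<in> {0..1}" "f 1 \<in> {0..1}" unfolding im .
  then have "f 0 = 0" "f 1 = 1" using le[of 0 x] le[of y 1] x y by auto
  then show ?R using f g by (auto simp: Hplus_carrier_def homeomorphism_def)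
next
  assume R: ?R
  then have mono: "strict_mono_on {0..1} f" and cont: "continuous_on {0..1} f" by auto
  have le: "f x \<le> f y" if "x \<in> {0..1}" "y \<in> {0..1}" "x \<le> y" for x y
    using strict_mono_on_leD[OF mono that] .
  have "f ` {0..1} = {0..1}"
  proof
    show "f ` {0..1} \<subseteq> {0..1}" using le[of 0] le[of _ 1] R by auto
    show "{0..1} \<subseteq> f ` {0..1}"
    proof
      fix y :: real assume "y \<in> {0..1}"
      then obtain x where "0 \<le> x" "x \<le> 1" "f x = y" using IVT'[of f 0 y 1] cont R by auto
      then show "y \<in> f ` {0..1}" by auto
    qed
  qed
  then have "\<exists>g. homeomorphism {0..1} {0..1} f g"
    using homeomorphism_compact[OF compact_Icc cont] strict_mono_on_imp_inj_on[OF mono] by blast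
  then show ?L using R by (auto simp: Hplus_carrier_def)
qed

lemma Hplus_0: "f \<in> Hplus_carrier \<Longrightarrow> f 0 = 0"
  and Hplus_1: "f \<in> Hplus_carrier \<Longrightarrow> f 1 = 1"
  and Hplus_continuous: "f \<in> Hplus_carrier \<Longrightarrow> continuous_on {0..1} f"
  by (auto simp: Hplus_carrier_iff)

lemma Hplus_less_iff:
  "\<lbrakk>f \<in> Hplus_carrier; p \<in> {0..1}; q \<in> {0..1}\<rbrakk> \<Longrightarrow> f p < f q \<longleftrightarrow> p < q"
  using strict_mono_on_less[of "{0..1}" f p q] by (auto simp: Hplus_carrier_iff)

lemma Hplus_le_iff:
  "\<lbrakk>f \<in> Hplus_carrier; p \<in> {0..1}; q \<in> {0..1}\<rbrakk> \<Longrightarrow> f p \<le> f q \<longleftrightarrow> p \<le> q"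
  using Hplus_less_iff[of f q p] by linarith

lemma Hplus_eq_iff:
  "\<lbrakk>f \<in> Hplus_carrier; p \<in> {0..1}; q \<in> {0..1}\<rbrakk> \<Longrightarrow> f p = f q \<longleftrightarrow> p = q"
  by (metis Hplus_less_iff less_irrefl linorder_neqE)

lemma Hplus_mem: "\<lbrakk>f \<in> Hplus_carrier; p \<in> {0..1}\<rbrakk> \<Longrightarrow> f p \<in> {0..1}"
  using Hplus_le_iff[of f 0 p] Hplus_le_iff[of f p 1] by (auto simp: Hplus_carrier_iff)

lemma Hplus_mem_greaterThanLessThan: "\<lbrakk>f \<in> Hplus_carrier; p \<in> {0<..<1}\<rbrakk> \<Longrightarrow> f p \<in> {0<..<1}"
  using Hplus_less_iff[of f 0 p] Hplus_less_iff[of f p 1] by (auto simp: Hplus_carrier_iff)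

lemma Hplus_eqI:
  "\<lbrakk>f \<in> Hplus_carrier; g \<in> Hplus_carrier; \<And>p. p \<in> {0..1} \<Longrightarrow> f p = g p\<rbrakk> \<Longrightarrow> f = g"
  by (rule extensionalityI[of _ "{0..1}"]) (auto simp: Hplus_carrier_iff)

lemma Hplus_restrictI:
  assumes "continuous_on {0..1} f" "strict_mono_on {0..1} f" "f 0 = 0" "f 1 = 1"
  shows "restrict f {0..1} \<in> Hplus_carrier"
  unfolding Hplus_carrier_iff
proof (intro conjI)
  show "continuous_on {0..1} (restrict f {0..1})"
    using assms(1) by (rule continuous_on_eq) simp
qed (use assms in \<open>auto simp: strict_mono_on_def\<close>)

lemma Hplus_mult_closed: "f \<in> Hplus_carrier \<Longrightarrow> g \<in> Hplus_carrier \<Longrightarrow> f \<otimes>\<^bsub>Hplus\<^esub> g \<in> Hplus_carrier"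
  and Hplus_inv_closed: "f \<in> Hplus_carrier \<Longrightarrow> inv\<^bsub>Hplus\<^esub> f \<in> Hplus_carrier"
  and Hplus_one_closed: "\<one>\<^bsub>Hplus\<^esub> \<in> Hplus_carrier"
  using Hp.m_closed Hp.inv_closed Hp.one_closed by auto

lemma one_Hplus_apply: "p \<in> {0..1} \<Longrightarrow> \<one>\<^bsub>Hplus\<^esub> p = p"
  by (simp add: one_Hplus)

lemma mult_Hplus_apply:
  "\<lbrakk>f \<in> Hplus_carrier; g \<in> Hplus_carrier; p \<in> {0..1}\<rbrakk> \<Longrightarrow> (f \<otimes>\<^bsub>Hplus\<^esub> g) p = f (g p)"
  by (simp add: mult_Hplus compose_def)

lemma inv_Hplus_apply:
  assumes "f \<in> Hplus_carrier" "p \<in> {0..1}"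
  shows "(inv\<^bsub>Hplus\<^esub> f) (f p) = p" "f ((inv\<^bsub>Hplus\<^esub> f) p) = p"
proof -
  have "inv\<^bsub>Hplus\<^esub> f \<otimes>\<^bsub>Hplus\<^esub> f = \<one>\<^bsub>Hplus\<^esub>" "f \<otimes>\<^bsub>Hplus\<^esub> inv\<^bsub>Hplus\<^esub> f = \<one>\<^bsub>Hplus\<^esub>"
    using assms by (simp_all add: Hp.l_inv Hp.r_inv)
  then show "(inv\<^bsub>Hplus\<^esub> f) (f p) = p" "f ((inv\<^bsub>Hplus\<^esub> f) p) = p"
    using mult_Hplus_apply[of "inv\<^bsub>Hplus\<^esub> f" f p] mult_Hplus_apply[of f "inv\<^bsub>Hplus\<^esub> f" p]
      one_Hplus_apply[of p] Hplus_inv_closed[of f] assms by auto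
qed

lemmas Hplus_intros = Hplus_mult_closed Hplus_inv_closed Hplus_one_closed Hplus_mem
lemmas Hplus_apply = one_Hplus_apply mult_Hplus_apply inv_Hplus_apply

lemma inv_Hplus_eqI:
  assumes "f \<in> Hplus_carrier" "p \<in> {0..1}" "f p = q"
  shows "(inv\<^bsub>Hplus\<^esub> f) q = p"
  using assms inv_Hplus_apply(1) by blast

section \<open>Homeomorphisms supported in an interval\<close>

definition Hsupp :: "real \<Rightarrow> real \<Rightarrow> (real \<Rightarrow> real) set" where
  "Hsupp u v = {f \<in> Hplus_carrier. \<forall>p\<in>{0..1}. p \<le> u \<or> v \<le> p \<longrightarrow> f p = p}"

lemma Hsupp_carrier: "f \<in> Hsupp u v \<Longrightarrow> f \<in> Hplus_carrier"
  by (simp add: Hsupp_def)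

lemma Hsupp_fix: "\<lbrakk>f \<in> Hsupp u v; p \<in> {0..1}; p \<le> u \<or> v \<le> p\<rbrakk> \<Longrightarrow> f p = p"
  unfolding Hsupp_def by blast

lemma Hsupp_0_1: "Hsupp 0 1 = Hplus_carrier"
proof -
  have "f p = p" if "f \<in> Hplus_carrier" "p \<in> {0..1}" "p \<le> 0 \<or> 1 \<le> p" for f p
  proof -
    have "p = 0 \<or> p = 1" using that by auto
    then show ?thesis using Hplus_0 Hplus_1 that by blast
  qed
  then show ?thesis by (auto simp: Hsupp_def)
qed

lemma Hsupp_mono: "\<lbrakk>u' \<le> u; v \<le> v'\<rbrakk> \<Longrightarrow> Hsupp u v \<subseteq> Hsupp u' v'"
  by (auto simp: Hsupp_def)

lemma Hsupp_mult: "\<lbrakk>f \<in> Hsupp u v; g \<in> Hsupp u v\<rbrakk> \<Longrightarrow> f \<otimes>\<^bsub>Hplus\<^esub> g \<in> Hsupp u v"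
  by (auto simp: Hsupp_def mult_Hplus_apply Hplus_mult_closed)

lemma Hsupp_inv: "f \<in> Hsupp u v \<Longrightarrow> inv\<^bsub>Hplus\<^esub> f \<in> Hsupp u v"
  unfolding Hsupp_def using Hplus_inv_closed inv_Hplus_eqI by blast

lemma Hsupp_one: "\<one>\<^bsub>Hplus\<^esub> \<in> Hsupp u v"
  by (auto simp: Hsupp_def Hplus_one_closed one_Hplus_apply)

lemma Hsupp_maps_interval:
  assumes "f \<in> Hsupp u v" "0 \<le> u" "u < v" "v \<le> 1" "p \<in> {u<..<v}"
  shows "f p \<in> {u<..<v}"
proof -
  have "f u = u" "f v = v" using assms Hsupp_fix[of f u v u] Hsupp_fix[of f u v v] by auto
  then show ?thesis
    using assms Hplus_less_iff[OF Hsupp_carrier[OF assms(1)], of u p]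
      Hplus_less_iff[OF Hsupp_carrier[OF assms(1)], of p v] by auto
qed

lemma Hsupp_commute:
  assumes f: "f \<in> Hsupp u v" and g: "g \<in> Hsupp v w" and "0 \<le> u" "u < v" "v < w" "w \<le> 1"
  shows "f \<otimes>\<^bsub>Hplus\<^esub> g = g \<otimes>\<^bsub>Hplus\<^esub> f"
proof (rule Hplus_eqI)
  note [simp] = Hsupp_carrier[OF f] Hsupp_carrier[OF g]
  show "f \<otimes>\<^bsub>Hplus\<^esub> g \<in> Hplus_carrier" "g \<otimes>\<^bsub>Hplus\<^esub> f \<in> Hplus_carrier"
    by (simp_all add: Hplus_mult_closed)
  fix p :: real assume p: "p \<in> {0..1}"
  consider "p \<in> {u<..<v}" | "p \<in> {v<..<w}" | "p \<le> u \<or> p = v \<or> w \<le> p" by fastforce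
  then have "f (g p) = g (f p)"
  proof cases
    case 1
    then have "f p \<in> {u<..<v}" using Hsupp_maps_interval[OF f] assms by auto
    then have "g (f p) = f p" "g p = p" using 1 assms by (auto intro!: Hsupp_fix[OF g])
    then show ?thesis by simp
  next
    case 2
    then have "g p \<in> {v<..<w}" using Hsupp_maps_interval[OF g] assms by auto
    then have "f (g p) = g p" "f p = p" using 2 assms by (auto intro!: Hsupp_fix[OF f])
    then show ?thesis by simp
  next
    case 3
    then have "f p = p" "g p = p" using p assms
      by (auto intro!: Hsupp_fix[OF f] Hsupp_fix[OF g])
    then show ?thesis by simp
  qed
  then show "(f \<otimes>\<^bsub>Hplus\<^esub> g) p = (g \<otimes>\<^bsub>Hplus\<^esub> f) p" using p by (simp add: mult_Hplus_apply)
qed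

lemma Hsupp_conj:
  assumes f: "f \<in> Hsupp u v" and d: "d \<in> Hplus_carrier" and uv: "u \<in> {0..1}" "v \<in> {0..1}"
  shows "d \<otimes>\<^bsub>Hplus\<^esub> f \<otimes>\<^bsub>Hplus\<^esub> inv\<^bsub>Hplus\<^esub> d \<in> Hsupp (d u) (d v)"
  unfolding Hsupp_def
proof (safe)
  note [simp] = Hsupp_carrier[OF f] d
  show "d \<otimes>\<^bsub>Hplus\<^esub> f \<otimes>\<^bsub>Hplus\<^esub> inv\<^bsub>Hplus\<^esub> d \<in> Hplus_carrier"
    by (simp add: Hplus_intros)
  fix p :: real assume p: "p \<in> {0..1}"
  let ?q = "(inv\<^bsub>Hplus\<^esub> d) p"
  have q: "?q \<in> {0..1}" "d ?q = p" using p Hplus_mem[OF Hplus_inv_closed[OF d] p] by (simp_all add: Hplus_apply d del: atLeastAtMost_iff)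
  have e: "(d \<otimes>\<^bsub>Hplus\<^esub> f \<otimes>\<^bsub>Hplus\<^esub> inv\<^bsub>Hplus\<^esub> d) p = d (f ?q)"
    using p q by (simp add: mult_Hplus_apply Hplus_intros)
  { assume "p \<le> d u" then have "?q \<le> u" using q uv Hplus_le_iff[OF d, of ?q u] by auto
    then show "(d \<otimes>\<^bsub>Hplus\<^esub> f \<otimes>\<^bsub>Hplus\<^esub> inv\<^bsub>Hplus\<^esub> d) p = p" using e q Hsupp_fix[OF f, of ?q] by auto }
  { assume "d v \<le> p" then have "v \<le> ?q" using q uv Hplus_le_iff[OF d, of v ?q] by auto
    then show "(d \<otimes>\<^bsub>Hplus\<^esub> f \<otimes>\<^bsub>Hplus\<^esub> inv\<^bsub>Hplus\<^esub> d) p = p" using e q Hsupp_fix[OF f, of ?q] by auto }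
qed

lemma glue_increasing:
  fixes f g :: "real \<Rightarrow> real"
  assumes "a \<le> c" "c \<le> b"
    and f: "continuous_on {a..c} f" "strict_mono_on {a..c} f"
    and g: "continuous_on {c..b} g" "strict_mono_on {c..b} g" and eq: "f c = g c"
  shows "continuous_on {a..b} (\<lambda>x. if x \<le> c then f x else g x)"
    and "strict_mono_on {a..b} (\<lambda>x. if x \<le> c then f x else g x)"
proof -
  have ab: "{a..b} = {a..c} \<union> {c..b}" using assms by auto
  show "continuous_on {a..b} (\<lambda>x. if x \<le> c then f x else g x)"
    unfolding ab by (rule continuous_on_cases) (use assms in auto)
  show "strict_mono_on {a..b} (\<lambda>x. if x \<le> c then f x else g x)"
  proof (rule strict_mono_onI)
    fix x y assume xy: "x \<in> {a..b}" "y \<in> {a..b}" "x < y"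
    consider "y \<le> c" | "c < x" | "x \<le> c" "c < y" by linarith
    then show "(if x \<le> c then f x else g x) < (if y \<le> c then f y else g y)"
    proof cases
      case 1 then show ?thesis using xy strict_mono_onD[OF f(2), of x y] by auto
    next
      case 2 then show ?thesis using xy strict_mono_onD[OF g(2), of x y] by auto
    next
      case 3
      have "f x \<le> f c" using 3 xy assms by (intro strict_mono_on_leD[OF f(2)]) auto
      also have "\<dots> < g y" unfolding eq using 3 xy assms by (intro strict_mono_onD[OF g(2)]) auto
      finally show ?thesis using 3 by auto
    qed
  qed
qed

text \<open>The tool for building homeomorphisms with prescribed support out of explicit increasing functions
  on \<open>[u,v]\<close>: two applications of \<open>glue_increasing\<close> attach the identity on both sides.\<close>

lemma Hsupp_extendI:
  assumes uv: "0 \<le> u" "u \<le> v" "v \<le> 1"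
    and F: "continuous_on {u..v} F" "strict_mono_on {u..v} F" "F u = u" "F v = v"
  shows "(\<lambda>x\<in>{0..1}. if x \<le> u \<or> v \<le> x then x else F x) \<in> Hsupp u v"
proof -
  define F1 where "F1 = (\<lambda>x. if x \<le> v then F x else x)"
  have id: "continuous_on S (\<lambda>x. x)" "strict_mono_on S (\<lambda>x. x)" for S :: "real set"
    by (auto simp: strict_mono_on_def)
  have 1: "continuous_on {u..1} F1" "strict_mono_on {u..1} F1"
    unfolding F1_def using glue_increasing[OF uv(2,3) F(1,2) id F(4)] by blast+
  define F2 where "F2 = (\<lambda>x. if x \<le> u then x else F1 x)"
  have "u = F1 u" using F uv by (simp add: F1_def)
  then have 2: "continuous_on {0..1} F2" "strict_mono_on {0..1} F2"
    unfolding F2_def using glue_increasing[OF uv(1) _ id 1] uv by (meson order_trans)+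
  have eq: "F2 = (\<lambda>x. if x \<le> u \<or> v \<le> x then x else F x)"
    using F by (auto simp: F2_def F1_def fun_eq_iff)
  have "restrict F2 {0..1} \<in> Hplus_carrier"
    by (rule Hplus_restrictI) (use 2 uv F in \<open>auto simp: F2_def F1_def\<close>)
  then show ?thesis by (simp add: Hsupp_def eq)
qed

lemma Hsupp_transitive:
  assumes uv: "0 \<le> u" "v \<le> 1" and p: "p \<in> {u<..<v}" and p': "p' \<in> {u<..<v}"
  obtains d where "d \<in> Hsupp u v" "d p = p'"
proof -
  define k l where "k = (p'-u)/(p-u)" and "l = (v-p')/(v-p)"
  define F where "F = (\<lambda>x. if x \<le> p then u + (x-u)*k else v - (v-x)*l)"
  have pos: "k > 0" "l > 0" using p p' by (auto simp: k_def l_def)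
  have kl: "u + (p-u)*k = p'" "v - (v-p)*l = p'" using p by (auto simp: k_def l_def)
  have up: "u \<le> p" "p \<le> v" using p by auto
  have m: "strict_mono_on S (\<lambda>x. u + (x-u)*k)" "strict_mono_on S (\<lambda>x. v - (v-x)*l)" for S
    using pos by (simp_all add: strict_mono_on_def)
  have cont: "continuous_on S (\<lambda>x. u + (x-u)*k)" "continuous_on S (\<lambda>x. v - (v-x)*l)" for S
    by (intro continuous_intros)+
  have c: "continuous_on {u..v} F" "strict_mono_on {u..v} F"
    unfolding F_def using glue_increasing[OF up cont(1) m(1) cont(2) m(2)] kl by auto
  have "F u = u" "F v = v" "F p = p'" using p kl by (auto simp: F_def)
  then show thesis
    using Hsupp_extendI[OF _ _ _ c] uv p p' that[of "\<lambda>x\<in>{0..1}. if x \<le> u \<or> v \<le> x then x else F x"] by auto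
qed

section \<open>Continuous actions on the interval: orbits and limits\<close>

text \<open>With \<open>c\<close> close to \<open>v\<close>, rescale the graph of \<open>f\<close> over \<open>[u,c]\<close> vertically so that it ends at the
  diagonal point \<open>(c,c)\<close>, and continue by the identity. As \<open>c\<close> tends to \<open>v\<close>, so does \<open>f(c)\<close>, and the
  scaling factor tends to \<open>1\<close>.\<close>

lemma Hsupp_approx_right:
  assumes uv: "0 \<le> u" "u < v" "v \<le> 1" and f: "f \<in> Hsupp u v"
  shows "\<exists>F. (\<forall>n::nat. \<exists>c\<in>{u<..<v}. F n \<in> Hsupp u c) \<and> (\<forall>p\<in>{0..1}. (\<lambda>n. F n p) \<longlonglongrightarrow> f p)"
proof -
  note fH = Hsupp_carrier[OF f]
  have fu: "f u = u" "f v = v" using Hsupp_fix[OF f, of u] Hsupp_fix[OF f, of v] uv by auto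
  define c where "c = (\<lambda>n::nat. v - (v-u) / real (n+2))"
  have c: "c n \<in> {u<..<v}" for n
  proof -
    have "(v-u) * 1 < (v-u) * real (n+2)" using uv by (intro mult_strict_left_mono) auto
    then have "(v-u) / real (n+2) < v-u" by (simp add: divide_less_eq)
    then show ?thesis using uv by (auto simp: c_def)
  qed
  have c_lim: "c \<longlonglongrightarrow> v"
    using tendsto_diff[OF tendsto_const LIMSEQ_ignore_initial_segment[OF lim_const_over_n[of "v-u"], of 2], of v]
    by (simp add: c_def)
  have fc: "f (c n) \<in> {u<..<v}" for n using Hsupp_maps_interval[OF f uv c] .
  have c01: "c n \<in> {0..1}" for n using c[of n] uv by auto
  have fc_lim: "(\<lambda>n. f (c n)) \<longlonglongrightarrow> v"
    using continuous_on_tendsto_compose[OF Hplus_continuous[OF fH] c_lim _ always_eventually] c01 uv fu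
    by (simp del: atLeastAtMost_iff) simp
  define k where "k = (\<lambda>n. (c n - u) / (f (c n) - u))"
  have k: "k n > 0" "u + (f (c n) - u) * k n = c n" for n using c[of n] fc[of n] by (auto simp: k_def)
  have k_lim: "k \<longlonglongrightarrow> (v-u)/(v-u)"
    unfolding k_def using uv by (intro tendsto_intros c_lim fc_lim) auto
  define F where "F = (\<lambda>n. \<lambda>x\<in>{0..1}. if x \<le> u \<or> c n \<le> x then x else u + (f x - u) * k n)"
  show ?thesis
  proof (intro exI[of _ F] conjI allI ballI)
    show "\<exists>c\<in>{u<..<v}. F n \<in> Hsupp u c" for n
    proof (rule bexI[OF _ c[of n]])
      show "F n \<in> Hsupp u (c n)"
        unfolding F_def
      proof (rule Hsupp_extendI)
        have sub: "{u..c n} \<subseteq> {0..1}" using c[of n] uv by auto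
        show "continuous_on {u..c n} (\<lambda>x. u + (f x - u) * k n)"
          by (intro continuous_intros continuous_on_subset[OF Hplus_continuous[OF fH] sub])
        show "strict_mono_on {u..c n} (\<lambda>x. u + (f x - u) * k n)"
        proof (rule strict_mono_onI)
          fix x y assume "x \<in> {u..c n}" "y \<in> {u..c n}" "x < y"
          then have "f x < f y" using Hplus_less_iff[OF fH] sub by auto
          then show "u + (f x - u) * k n < u + (f y - u) * k n" using k(1)[of n] by simp
        qed
      qed (use uv c[of n] fu k(2)[of n] in auto)
    qed
    fix p :: real assume p: "p \<in> {0..1}"
    show "(\<lambda>n. F n p) \<longlonglongrightarrow> f p"
    proof (cases "p \<le> u \<or> v \<le> p")
      case True
      then have "F n p = f p" for n using p c[of n] Hsupp_fix[OF f p] by (auto simp: F_def)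
      then show ?thesis by simp
    next
      case False
      then have "\<forall>\<^sub>F n in sequentially. p < c n" using order_tendstoD(1)[OF c_lim] by auto
      then have ev: "\<forall>\<^sub>F n in sequentially. u + (f p - u) * k n = F n p"
        by eventually_elim (use False p in \<open>auto simp: F_def\<close>)
      have "(\<lambda>n. u + (f p - u) * k n) \<longlonglongrightarrow> u + (f p - u) * ((v-u)/(v-u))"
        by (intro tendsto_intros k_lim)
      then have "(\<lambda>n. u + (f p - u) * k n) \<longlonglongrightarrow> f p" using uv by simp
      then show ?thesis using Lim_transform_eventually[OF _ ev] by simp
    qed
  qed
qed

text \<open>The mirror image of \<open>Hsupp_approx_right\<close>, rescaling towards the right end point.\<close>

lemma Hsupp_approx_left:
  assumes uv: "0 \<le> u" "u < v" "v \<le> 1" and f: "f \<in> Hsupp u v"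
  shows "\<exists>F. (\<forall>n::nat. \<exists>c\<in>{u<..<v}. F n \<in> Hsupp c v) \<and> (\<forall>p\<in>{0..1}. (\<lambda>n. F n p) \<longlonglongrightarrow> f p)"
proof -
  note fH = Hsupp_carrier[OF f]
  have fu: "f u = u" "f v = v" using Hsupp_fix[OF f, of u] Hsupp_fix[OF f, of v] uv by auto
  define c where "c = (\<lambda>n::nat. u + (v-u) / real (n+2))"
  have c: "c n \<in> {u<..<v}" for n
  proof -
    have "(v-u) * 1 < (v-u) * real (n+2)" using uv by (intro mult_strict_left_mono) auto
    then have "(v-u) / real (n+2) < v-u" by (simp add: divide_less_eq)
    then show ?thesis using uv by (auto simp: c_def)
  qed
  have c_lim: "c \<longlonglongrightarrow> u"
    using tendsto_add[OF tendsto_const LIMSEQ_ignore_initial_segment[OF lim_const_over_n[of "v-u"], of 2], of u]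
    by (simp add: c_def)
  have fc: "f (c n) \<in> {u<..<v}" for n using Hsupp_maps_interval[OF f uv c] .
  have c01: "c n \<in> {0..1}" for n using c[of n] uv by auto
  have fc_lim: "(\<lambda>n. f (c n)) \<longlonglongrightarrow> u"
    using continuous_on_tendsto_compose[OF Hplus_continuous[OF fH] c_lim _ always_eventually] c01 uv fu
    by (simp del: atLeastAtMost_iff) simp
  define k where "k = (\<lambda>n. (v - c n) / (v - f (c n)))"
  have k: "k n > 0" "v - (v - f (c n)) * k n = c n" for n using c[of n] fc[of n] by (auto simp: k_def)
  have k_lim: "k \<longlonglongrightarrow> (v-u)/(v-u)"
    unfolding k_def using uv by (intro tendsto_intros c_lim fc_lim) auto
  define F where "F = (\<lambda>n. \<lambda>x\<in>{0..1}. if x \<le> c n \<or> v \<le> x then x else v - (v - f x) * k n)"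
  show ?thesis
  proof (intro exI[of _ F] conjI allI ballI)
    show "\<exists>c\<in>{u<..<v}. F n \<in> Hsupp c v" for n
    proof (rule bexI[OF _ c[of n]])
      show "F n \<in> Hsupp (c n) v"
        unfolding F_def
      proof (rule Hsupp_extendI)
        have sub: "{c n..v} \<subseteq> {0..1}" using c[of n] uv by auto
        show "continuous_on {c n..v} (\<lambda>x. v - (v - f x) * k n)"
          by (intro continuous_intros continuous_on_subset[OF Hplus_continuous[OF fH] sub])
        show "strict_mono_on {c n..v} (\<lambda>x. v - (v - f x) * k n)"
        proof (rule strict_mono_onI)
          fix x y assume "x \<in> {c n..v}" "y \<in> {c n..v}" "x < y"
          then have "f x < f y" using Hplus_less_iff[OF fH] sub by auto
          then show "v - (v - f x) * k n < v - (v - f y) * k n" using k(1)[of n] by simp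
        qed
      qed (use uv c[of n] fu k(2)[of n] in auto)
    qed
    fix p :: real assume p: "p \<in> {0..1}"
    show "(\<lambda>n. F n p) \<longlonglongrightarrow> f p"
    proof (cases "p \<le> u \<or> v \<le> p")
      case True
      then have "F n p = f p" for n using p c[of n] Hsupp_fix[OF f p] by (auto simp: F_def)
      then show ?thesis by simp
    next
      case False
      then have "\<forall>\<^sub>F n in sequentially. c n < p" using order_tendstoD(2)[OF c_lim] by auto
      then have ev: "\<forall>\<^sub>F n in sequentially. v - (v - f p) * k n = F n p"
        by eventually_elim (use False p in \<open>auto simp: F_def\<close>)
      have "(\<lambda>n. v - (v - f p) * k n) \<longlonglongrightarrow> v - (v - f p) * ((v-u)/(v-u))"
        by (intro tendsto_intros k_lim)
      then have "(\<lambda>n. v - (v - f p) * k n) \<longlonglongrightarrow> f p" using uv by simp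
      then show ?thesis using Lim_transform_eventually[OF _ ev] by simp
    qed
  qed
qed

text \<open>Convex combinations with the identity join every element of \<open>Hsupp u v\<close> to the identity inside
  \<open>Hsupp u v\<close>; this is the source of connectedness of orbits.\<close>

lemma Hsupp_path:
  assumes f: "f \<in> Hsupp u v" and s: "s \<in> {0..1}"
  shows "(\<lambda>p\<in>{0..1}. (1 - s) * p + s * f p) \<in> Hsupp u v"
proof -
  note fH = Hsupp_carrier[OF f]
  have "(\<lambda>p\<in>{0..1}. (1 - s) * p + s * f p) \<in> Hplus_carrier"
  proof (rule Hplus_restrictI)
    show "continuous_on {0..1} (\<lambda>p. (1 - s) * p + s * f p)"
      by (intro continuous_intros Hplus_continuous[OF fH])
    show "strict_mono_on {0..1} (\<lambda>p. (1 - s) * p + s * f p)"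
    proof (rule strict_mono_onI)
      fix p q :: real assume pq: "p \<in> {0..1}" "q \<in> {0..1}" "p < q"
      then have "f p < f q" using Hplus_less_iff[OF fH] by auto
      show "(1 - s) * p + s * f p < (1 - s) * q + s * f q"
      proof (cases "s = 0")
        case False
        then have "s * f p < s * f q" "(1 - s) * p \<le> (1 - s) * q"
          using s pq \<open>f p < f q\<close> by (auto intro: mult_left_mono)
        then show ?thesis by simp
      qed (use pq in simp)
    qed
  qed (simp_all add: Hplus_0[OF fH] Hplus_1[OF fH])
  moreover have "(1 - s) * p + s * f p = p" if "p \<in> {0..1}" "p \<le> u \<or> v \<le> p" for p
    using Hsupp_fix[OF f that] by (simp add: algebra_simps)
  ultimately show ?thesis unfolding Hsupp_def by auto
qed

text \<open>Homomorphisms of \<open>Hplus\<close> into itself are regarded as actions of \<open>Hplus\<close> on \<open>[0,1]\<close>. Continuity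
  is recorded in the form in which it is used, namely for pointwise limits of sequences; on \<open>Hplus\<close>
  these are the same as uniform limits (\<open>pointwise_imp_limitin_Hplus\<close>).\<close>

locale Hplus_action =
  fixes \<phi> :: "(real \<Rightarrow> real) \<Rightarrow> real \<Rightarrow> real"
  assumes hom: "\<phi> \<in> hom Hplus Hplus"
    and pointwise_continuous:
      "\<lbrakk>\<And>n. F n \<in> Hplus_carrier; f \<in> Hplus_carrier; \<And>p. p \<in> {0..1} \<Longrightarrow> (\<lambda>n. F n p) \<longlonglongrightarrow> f p;
        x \<in> {0..1}\<rbrakk> \<Longrightarrow> (\<lambda>n::nat. \<phi> (F n) x) \<longlonglongrightarrow> \<phi> f x"
begin

lemma act_closed: "f \<in> Hplus_carrier \<Longrightarrow> \<phi> f \<in> Hplus_carrier"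
  using hom by (auto simp: hom_def)

lemma act_mem: "\<lbrakk>f \<in> Hplus_carrier; x \<in> {0..1}\<rbrakk> \<Longrightarrow> \<phi> f x \<in> {0..1}"
  by (rule Hplus_mem[OF act_closed])

lemma act_mult:
  "\<lbrakk>f \<in> Hplus_carrier; g \<in> Hplus_carrier; x \<in> {0..1}\<rbrakk> \<Longrightarrow> \<phi> (f \<otimes>\<^bsub>Hplus\<^esub> g) x = \<phi> f (\<phi> g x)"
  using hom by (simp add: hom_def mult_Hplus_apply act_closed)

lemma act_one: "x \<in> {0..1} \<Longrightarrow> \<phi> \<one>\<^bsub>Hplus\<^esub> x = x"
  using hom_one[OF hom group_Hplus group_Hplus] by (simp add: one_Hplus_apply)

lemma act_inv:
  assumes "f \<in> Hplus_carrier" "x \<in> {0..1}"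
  shows "\<phi> (inv\<^bsub>Hplus\<^esub> f) (\<phi> f x) = x" "\<phi> f (\<phi> (inv\<^bsub>Hplus\<^esub> f) x) = x"
proof -
  have "\<phi> (inv\<^bsub>Hplus\<^esub> f) (\<phi> f x) = \<phi> (inv\<^bsub>Hplus\<^esub> f \<otimes>\<^bsub>Hplus\<^esub> f) x"
    "\<phi> f (\<phi> (inv\<^bsub>Hplus\<^esub> f) x) = \<phi> (f \<otimes>\<^bsub>Hplus\<^esub> inv\<^bsub>Hplus\<^esub> f) x"
    using assms by (simp_all only: act_mult Hplus_inv_closed)
  then show "\<phi> (inv\<^bsub>Hplus\<^esub> f) (\<phi> f x) = x" "\<phi> f (\<phi> (inv\<^bsub>Hplus\<^esub> f) x) = x"
    using assms by (simp_all add: act_one Hp.l_inv Hp.r_inv)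
qed

lemma act_inv_eq:
  "\<lbrakk>f \<in> Hplus_carrier; x \<in> {0..1}; \<phi> f x = y\<rbrakk> \<Longrightarrow> \<phi> (inv\<^bsub>Hplus\<^esub> f) y = x"
  using act_inv(1) by blast

lemma act_less_iff:
  "\<lbrakk>f \<in> Hplus_carrier; x \<in> {0..1}; y \<in> {0..1}\<rbrakk> \<Longrightarrow> \<phi> f x < \<phi> f y \<longleftrightarrow> x < y"
  by (rule Hplus_less_iff[OF act_closed])

lemma act_eq_iff:
  "\<lbrakk>f \<in> Hplus_carrier; x \<in> {0..1}; y \<in> {0..1}\<rbrakk> \<Longrightarrow> \<phi> f x = \<phi> f y \<longleftrightarrow> x = y"
  by (rule Hplus_eq_iff[OF act_closed])

text \<open>Along the path from the identity to \<open>f\<close> the point \<open>x\<close> moves continuously to \<open>\<phi> f x\<close>.\<close>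

lemma orbit_intermediate_value:
  assumes f: "f \<in> Hsupp u v" and x: "x \<in> {0..1}" and y: "x \<le> y" "y \<le> \<phi> f x"
  obtains f' where "f' \<in> Hsupp u v" "\<phi> f' x = y"
proof -
  note fH = Hsupp_carrier[OF f]
  define P where "P = (\<lambda>s. \<lambda>p\<in>{0..1}. (1 - s) * p + s * f p)"
  have P: "P s \<in> Hsupp u v" if "s \<in> {0..1}" for s
    unfolding P_def using Hsupp_path[OF f that] .
  have P01: "P 0 = \<one>\<^bsub>Hplus\<^esub>" "P 1 = f"
    using fH by (auto simp: P_def one_Hplus Hplus_carrier_iff extensional_def)
  have "continuous_on {0..1} (\<lambda>s. \<phi> (P s) x)"
    unfolding continuous_on_sequentially comp_def
  proof (intro allI ballI impI, elim conjE)
    fix s a assume a: "a \<in> {0..1::real}" and s: "\<forall>n. s n \<in> {0..1}" and lim: "s \<longlonglongrightarrow> a"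
    show "(\<lambda>n. \<phi> (P (s n)) x) \<longlonglongrightarrow> \<phi> (P a) x"
    proof (rule pointwise_continuous[OF _ _ _ x])
      show "P (s n) \<in> Hplus_carrier" for n using s P Hsupp_carrier by blast
      show "P a \<in> Hplus_carrier" using a P Hsupp_carrier by blast
      show "(\<lambda>n. P (s n) p) \<longlonglongrightarrow> P a p" if "p \<in> {0..1}" for p
        using that by (auto simp: P_def intro!: tendsto_intros lim)
    qed
  qed
  then obtain s where "0 \<le> s" "s \<le> 1" "\<phi> (P s) x = y"
    using IVT'[of "\<lambda>s. \<phi> (P s) x" 0 y 1] y x by (auto simp: P01 act_one)
  then show thesis using that P by auto
qed

definition fixes_supp :: "real \<Rightarrow> real \<Rightarrow> real \<Rightarrow> bool" where
  "fixes_supp u v x \<longleftrightarrow> (\<forall>f\<in>Hsupp u v. \<phi> f x = x)"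

lemma fixes_suppD: "\<lbrakk>fixes_supp u v x; f \<in> Hsupp u v\<rbrakk> \<Longrightarrow> \<phi> f x = x"
  by (simp add: fixes_supp_def)

lemma fixes_supp_limit_right:
  assumes uv: "0 \<le> u" "u < v" "v \<le> 1" and x: "x \<in> {0..1}"
    and fixed: "\<And>c. c \<in> {u<..<v} \<Longrightarrow> fixes_supp u c x"
  shows "fixes_supp u v x"
  unfolding fixes_supp_def
proof
  fix f assume f: "f \<in> Hsupp u v"
  obtain F where F: "\<And>n::nat. \<exists>c\<in>{u<..<v}. F n \<in> Hsupp u c"
    and lim: "\<And>p. p \<in> {0..1} \<Longrightarrow> (\<lambda>n. F n p) \<longlonglongrightarrow> f p"
    using Hsupp_approx_right[OF uv f] by blast
  have "(\<lambda>n. \<phi> (F n) x) \<longlonglongrightarrow> \<phi> f x"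
    by (rule pointwise_continuous[OF _ Hsupp_carrier[OF f] lim x]) (use F Hsupp_carrier in blast)
  moreover have "\<phi> (F n) x = x" for n using F fixed fixes_suppD by blast
  ultimately show "\<phi> f x = x" by (simp add: LIMSEQ_const_iff)
qed

lemma fixes_supp_limit_left:
  assumes uv: "0 \<le> u" "u < v" "v \<le> 1" and x: "x \<in> {0..1}"
    and fixed: "\<And>c. c \<in> {u<..<v} \<Longrightarrow> fixes_supp c v x"
  shows "fixes_supp u v x"
  unfolding fixes_supp_def
proof
  fix f assume f: "f \<in> Hsupp u v"
  obtain F where F: "\<And>n::nat. \<exists>c\<in>{u<..<v}. F n \<in> Hsupp c v"
    and lim: "\<And>p. p \<in> {0..1} \<Longrightarrow> (\<lambda>n. F n p) \<longlonglongrightarrow> f p"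
    using Hsupp_approx_left[OF uv f] by blast
  have "(\<lambda>n. \<phi> (F n) x) \<longlonglongrightarrow> \<phi> f x"
    by (rule pointwise_continuous[OF _ Hsupp_carrier[OF f] lim x]) (use F Hsupp_carrier in blast)
  moreover have "\<phi> (F n) x = x" for n using F fixed fixes_suppD by blast
  ultimately show "\<phi> f x = x" by (simp add: LIMSEQ_const_iff)
qed

text \<open>If \<open>f\<close> moves \<open>x\<close> down, its inverse moves \<open>x\<close> up.\<close>

lemma moves_up:
  assumes f: "f \<in> Hsupp u v" and x: "x \<in> {0..1}" and "\<phi> f x \<noteq> x"
  obtains f' where "f' \<in> Hsupp u v" "x < \<phi> f' x"
proof (cases "x < \<phi> f x")
  case False
  note fH = Hsupp_carrier[OF f]
  have "\<phi> f x < x" using False assms by simp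
  then have "\<phi> (inv\<^bsub>Hplus\<^esub> f) (\<phi> f x) < \<phi> (inv\<^bsub>Hplus\<^esub> f) x"
    using act_less_iff x fH by (simp add: Hplus_inv_closed act_mem del: atLeastAtMost_iff)
  then show thesis using that[OF Hsupp_inv[OF f]] act_inv(1)[OF fH x] by simp
qed (use that f in blast)

end

section \<open>Rigidity of continuous homomorphisms\<close>

text \<open>A homeomorphism supported in \<open>(0,b)\<close> can be conjugated, without leaving \<open>(0,c)\<close>, so that its
  support shrinks towards \<open>0\<close>. So its conjugates accumulate at the identity.\<close>

lemma Hsupp_squeeze:
  assumes f: "f \<in> Hsupp 0 b" and b: "0 < b" "b < c" "c \<le> 1"
  shows "\<exists>d. (\<forall>n::nat. d n \<in> Hsupp 0 c) \<and>
    (\<forall>p\<in>{0..1}. (\<lambda>n. (d n \<otimes>\<^bsub>Hplus\<^esub> f \<otimes>\<^bsub>Hplus\<^esub> inv\<^bsub>Hplus\<^esub> d n) p) \<longlonglongrightarrow> p)"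
proof -
  define r where "r = (\<lambda>n::nat. b / real (n+2))"
  have r: "r n \<in> {0<..<c}" for n
  proof -
    have "b * 1 < b * real (n+2)" using b by (intro mult_strict_left_mono) auto
    then have "b / real (n+2) < b" by (simp add: divide_less_eq)
    then show ?thesis using b by (auto simp: r_def)
  qed
  have r_lim: "r \<longlonglongrightarrow> 0"
    using LIMSEQ_ignore_initial_segment[OF lim_const_over_n[of b], of 2] by (simp add: r_def)
  have "\<exists>d. d \<in> Hsupp 0 c \<and> d b = r n" for n
    using Hsupp_transitive[of 0 c b "r n"] r[of n] b by (metis greaterThanLessThan_iff order_refl)
  then obtain d where d: "\<And>n. d n \<in> Hsupp 0 c" "\<And>n. d n b = r n" by metis
  have "(\<lambda>n. (d n \<otimes>\<^bsub>Hplus\<^esub> f \<otimes>\<^bsub>Hplus\<^esub> inv\<^bsub>Hplus\<^esub> d n) p) \<longlonglongrightarrow> p" if p: "p \<in> {0..1}" for p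
  proof -
    have supp: "d n \<otimes>\<^bsub>Hplus\<^esub> f \<otimes>\<^bsub>Hplus\<^esub> inv\<^bsub>Hplus\<^esub> d n \<in> Hsupp 0 (r n)" for n
      using Hsupp_conj[OF f Hsupp_carrier[OF d(1)[of n]]] b d(2)[of n] Hplus_0[OF Hsupp_carrier[OF d(1)[of n]]]
      by auto
    have "\<forall>\<^sub>F n in sequentially. p \<le> 0 \<or> r n \<le> p"
    proof (cases "p \<le> 0")
      case False
      then have "\<forall>\<^sub>F n in sequentially. r n < p" using order_tendstoD(2)[OF r_lim] by auto
      then show ?thesis by eventually_elim auto
    qed auto
    then have "\<forall>\<^sub>F n in sequentially. (d n \<otimes>\<^bsub>Hplus\<^esub> f \<otimes>\<^bsub>Hplus\<^esub> inv\<^bsub>Hplus\<^esub> d n) p = p"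
      by eventually_elim (rule Hsupp_fix[OF supp p])
    then show ?thesis by (rule tendsto_eventually)
  qed
  then show ?thesis using d(1) by blast
qed

context Hplus_action
begin

lemma act_commute:
  assumes "f \<in> Hsupp u v" "g \<in> Hsupp v w" "0 \<le> u" "u < v" "v < w" "w \<le> 1" "x \<in> {0..1}"
  shows "\<phi> f (\<phi> g x) = \<phi> g (\<phi> f x)"
  using act_mult[of f g x] act_mult[of g f x] Hsupp_commute[OF assms(1-6)] Hsupp_carrier assms
  by metis

text \<open>Let \<open>S\<close> be the orbit of \<open>x\<close> under the homeomorphisms supported in \<open>(b,1)\<close>. If \<open>S\<close> does not
  contain \<open>\<phi> f x\<close>, it stays below that point by the intermediate value property. Its supremum \<open>e\<close>
  is fixed by that group, but it is also on the way from \<open>x\<close> to \<open>\<phi> f x\<close>, so it is the image of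
  \<open>x\<close> under some element supported in \<open>(0,b)\<close>. As the two groups commute, \<open>x\<close> would then be fixed
  as well.\<close>

lemma orbit_subset_upward:
  assumes b: "b \<in> {0<..<1}" and x: "x \<in> {0..1}" and moved: "\<not> fixes_supp b 1 x"
    and f: "f \<in> Hsupp 0 b" and up: "x \<le> \<phi> f x"
  shows "\<exists>g\<in>Hsupp b 1. \<phi> g x = \<phi> f x"
proof (rule ccontr)
  assume none: "\<not> ?thesis"
  let ?y = "\<phi> f x"
  define S where "S = (\<lambda>g. \<phi> g x) ` Hsupp b 1"
  have lt: "z < ?y" if "z \<in> S" for z
  proof (rule ccontr)
    assume "\<not> z < ?y"
    moreover obtain g where g: "g \<in> Hsupp b 1" "z = \<phi> g x" using \<open>z \<in> S\<close> by (auto simp: S_def)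
    ultimately have "\<exists>g'\<in>Hsupp b 1. \<phi> g' x = ?y"
      using orbit_intermediate_value[OF g(1) x up] by auto
    then show False using none by blast
  qed
  have xS: "x \<in> S" using act_one[OF x] Hsupp_one[of b 1] unfolding S_def by (metis imageI)
  define e where "e = Sup S"
  have bdd: "bdd_above S" using lt by (meson bdd_above.I less_imp_le)
  have upper: "z \<le> e" if "z \<in> S" for z unfolding e_def using bdd that by (rule cSup_upper[rotated])
  have "e \<le> ?y" unfolding e_def using xS lt by (intro cSup_least less_imp_le) auto
  then have e: "x \<le> e" "e \<le> ?y" using upper[OF xS] by auto
  have y01: "?y \<in> {0..1}" using act_mem[OF Hsupp_carrier[OF f] x] .
  have e01: "e \<in> {0..1}" using e x y01 by auto
  have le: "\<phi> g e \<le> e" if g: "g \<in> Hsupp b 1" for g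
  proof (rule ccontr)
    note gH = Hsupp_carrier[OF g]
    assume "\<not> \<phi> g e \<le> e"
    then have "e < \<phi> g e" by simp
    then have "\<phi> (inv\<^bsub>Hplus\<^esub> g) e < e"
      using act_less_iff[OF Hplus_inv_closed[OF gH] e01 act_mem[OF gH e01]] act_inv(1)[OF gH e01] by simp
    then obtain z where z: "z \<in> S" "\<phi> (inv\<^bsub>Hplus\<^esub> g) e < z"
      unfolding e_def using less_cSupD[of S] xS by auto
    obtain g' where g': "g' \<in> Hsupp b 1" "z = \<phi> g' x" using z by (auto simp: S_def)
    have z01: "z \<in> {0..1}" using g' act_mem[OF Hsupp_carrier x] by blast
    have "\<phi> g (\<phi> (inv\<^bsub>Hplus\<^esub> g) e) < \<phi> g z"
      using act_less_iff[OF gH act_mem[OF Hplus_inv_closed[OF gH] e01] z01] z by simp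
    then have "e < \<phi> g z" using act_inv(2)[OF gH e01] by simp
    moreover have "\<phi> g z = \<phi> (g \<otimes>\<^bsub>Hplus\<^esub> g') x" using act_mult[OF gH Hsupp_carrier[OF g'(1)] x] g' by simp
    then have "\<phi> g z \<in> S" using Hsupp_mult[OF g g'(1)] by (auto simp: S_def)
    ultimately show False using upper by force
  qed
  have fix_e: "\<phi> g e = e" if g: "g \<in> Hsupp b 1" for g
  proof -
    note gH = Hsupp_carrier[OF g]
    have "\<not> e < \<phi> (inv\<^bsub>Hplus\<^esub> g) e" using le[OF Hsupp_inv[OF g]] by simp
    then have "\<not> \<phi> g e < e"
      using act_less_iff[OF Hplus_inv_closed[OF gH] act_mem[OF gH e01] e01] act_inv(1)[OF gH e01] by simp
    then show ?thesis using le[OF g] by simp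
  qed
  obtain f' where f': "f' \<in> Hsupp 0 b" "\<phi> f' x = e"
    using orbit_intermediate_value[OF f x e] .
  have "\<phi> g x = x" if g: "g \<in> Hsupp b 1" for g
  proof -
    have "\<phi> f' (\<phi> g x) = \<phi> g (\<phi> f' x)"
      using act_commute[OF f'(1) g] b x by simp
    also have "\<dots> = \<phi> f' x" using fix_e[OF g] f' by simp
    finally show ?thesis
      using act_eq_iff[OF Hsupp_carrier[OF f'(1)] act_mem[OF Hsupp_carrier[OF g] x] x] by simp
  qed
  then show False using moved by (simp add: fixes_supp_def)
qed

lemma orbit_subset:
  assumes b: "b \<in> {0<..<1}" and x: "x \<in> {0..1}" and moved: "\<not> fixes_supp b 1 x"
    and f: "f \<in> Hsupp 0 b"
  shows "\<exists>g\<in>Hsupp b 1. \<phi> g x = \<phi> f x"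
proof (cases "x \<le> \<phi> f x")
  case True
  then show ?thesis using orbit_subset_upward[OF assms] by simp
next
  case False
  note fH = Hsupp_carrier[OF f]
  have "x \<le> \<phi> (inv\<^bsub>Hplus\<^esub> f) x"
    using act_less_iff[OF Hplus_inv_closed[OF fH] act_mem[OF fH x] x] act_inv(1)[OF fH x] False by simp
  then obtain g where g: "g \<in> Hsupp b 1" "\<phi> g x = \<phi> (inv\<^bsub>Hplus\<^esub> f) x"
    using orbit_subset_upward[OF b x moved Hsupp_inv[OF f]] by blast
  note gH = Hsupp_carrier[OF g(1)]
  have "\<phi> g (\<phi> f x) = \<phi> f (\<phi> g x)" using act_commute[OF f g(1)] b x by simp
  also have "\<dots> = x" using g(2) act_inv(2)[OF fH x] by simp
  finally have "\<phi> (inv\<^bsub>Hplus\<^esub> g) x = \<phi> f x" using act_inv_eq[OF gH act_mem[OF fH x]] by simp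
  then show ?thesis using Hsupp_inv[OF g(1)] by blast
qed

text \<open>By \<open>orbit_subset\<close> the point \<open>\<phi> c x\<close> is also of the form \<open>\<phi> g x\<close> with \<open>g\<close> commuting with \<open>f\<close>. So
  the stabilizer of \<open>x\<close> in \<open>Hsupp 0 b\<close> acts trivially on the orbit and is a normal subgroup.\<close>

lemma stabilizer_fixes_orbit:
  assumes b: "b \<in> {0<..<1}" and x: "x \<in> {0..1}" and moved: "\<not> fixes_supp b 1 x"
    and f: "f \<in> Hsupp 0 b" "\<phi> f x = x" and c: "c \<in> Hsupp 0 b"
  shows "\<phi> f (\<phi> c x) = \<phi> c x"
proof -
  obtain g where g: "g \<in> Hsupp b 1" "\<phi> g x = \<phi> c x" using orbit_subset[OF b x moved c] by blast
  have "\<phi> f (\<phi> g x) = \<phi> g (\<phi> f x)" using act_commute[OF f(1) g(1)] b x by simp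
  then show ?thesis using f g by simp
qed

text \<open>If both groups move \<open>x\<close>, then \<open>x\<close> is moved by some element with support in a smaller interval
  \<open>(a,b')\<close>, and, by conjugation, also by one with support in \<open>(b'',b)\<close>, where \<open>b' < b'' < b\<close>:
  the stabilizer is normal and so cannot contain the conjugate. By the intermediate value property
  there are \<open>\<alpha>1\<close> and \<open>\<beta>1\<close> with these supports that move \<open>x\<close> up to the same point \<open>y\<close>; they agree on
  the whole orbit. An element \<open>\<delta>\<close> with support in \<open>(0,b'')\<close> commutes with \<open>\<beta>1\<close>, so conjugating
  \<open>\<alpha>1\<close> by \<open>\<delta>\<close> does not change the image \<open>y\<close> of \<open>x\<close>. But the conjugates of \<open>\<alpha>1\<close> come arbitrarily
  close to the identity, which gives \<open>y = x\<close>.\<close>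

lemma fixes_supp_left_or_right:
  assumes b: "b \<in> {0<..<1}" and x: "x \<in> {0..1}"
  shows "fixes_supp 0 b x \<or> fixes_supp b 1 x"
proof (rule ccontr)
  assume "\<not> ?thesis"
  then have moved_left: "\<not> fixes_supp 0 b x" and moved: "\<not> fixes_supp b 1 x" by auto
  note trivial = stabilizer_fixes_orbit[OF b x moved]
  obtain b' where b': "b' \<in> {0<..<b}" and "\<not> fixes_supp 0 b' x"
    using fixes_supp_limit_right[of 0 b x] moved_left b x by auto
  then obtain a where a: "a \<in> {0<..<b'}" and "\<not> fixes_supp a b' x"
    using fixes_supp_limit_left[of 0 b' x] b x by auto
  then obtain \<alpha>0 where \<alpha>0: "\<alpha>0 \<in> Hsupp a b'" "\<phi> \<alpha>0 x \<noteq> x" by (auto simp: fixes_supp_def)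
  obtain b'' where b'': "b' < b''" "b'' < b" using b' dense by auto
  have sub: "Hsupp a b' \<subseteq> Hsupp 0 b" "Hsupp 0 b' \<subseteq> Hsupp 0 b" "Hsupp 0 b'' \<subseteq> Hsupp 0 b"
    "Hsupp b'' b \<subseteq> Hsupp 0 b" "Hsupp a b' \<subseteq> Hsupp 0 b'"
    by (rule Hsupp_mono; use a b' b'' in simp)+
  obtain \<alpha> where \<alpha>: "\<alpha> \<in> Hsupp a b'" "x < \<phi> \<alpha> x" using moves_up[OF \<alpha>0(1) x \<alpha>0(2)] .
  obtain d where d: "d \<in> Hsupp 0 b" "d a = b''"
    using Hsupp_transitive[of 0 b a b''] a b' b'' b by auto
  note dH = Hsupp_carrier[OF d(1)]
  define \<beta>0 where "\<beta>0 = d \<otimes>\<^bsub>Hplus\<^esub> \<alpha>0 \<otimes>\<^bsub>Hplus\<^esub> inv\<^bsub>Hplus\<^esub> d"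
  have db: "d b' \<le> b" using Hsupp_maps_interval[OF d(1), of b'] b b' by auto
  have \<beta>0: "\<beta>0 \<in> Hsupp b'' b"
    using Hsupp_conj[OF \<alpha>0(1) dH] a b b' d(2) Hsupp_mono[of b'' b'' "d b'" b] db
    unfolding \<beta>0_def by auto
  have \<alpha>0H: "\<alpha>0 \<in> Hplus_carrier" using \<alpha>0 Hsupp_carrier by blast
  have "\<phi> \<beta>0 x \<noteq> x"
  proof
    assume "\<phi> \<beta>0 x = x"
    then have "\<phi> \<beta>0 (\<phi> d x) = \<phi> d x" using trivial[of \<beta>0 d] \<beta>0 sub d by blast
    moreover have "\<phi> \<beta>0 (\<phi> d x) = \<phi> d (\<phi> \<alpha>0 x)"
      unfolding \<beta>0_def
      using act_mult[OF Hplus_mult_closed[OF dH \<alpha>0H] Hplus_inv_closed[OF dH] act_mem[OF dH x]]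
        act_mult[OF dH \<alpha>0H x] act_inv(1)[OF dH x] by simp
    ultimately show False using act_eq_iff[OF dH act_mem[OF \<alpha>0H x] x] \<alpha>0 by simp
  qed
  then obtain \<beta> where \<beta>: "\<beta> \<in> Hsupp b'' b" "x < \<phi> \<beta> x" using moves_up[OF \<beta>0 x] by blast
  define y where "y = min (\<phi> \<alpha> x) (\<phi> \<beta> x)"
  have y: "x < y" "x \<le> y" "y \<le> \<phi> \<alpha> x" "y \<le> \<phi> \<beta> x" using \<alpha> \<beta> by (auto simp: y_def)
  obtain \<alpha>1 where \<alpha>1: "\<alpha>1 \<in> Hsupp a b'" "\<phi> \<alpha>1 x = y"
    using orbit_intermediate_value[OF \<alpha>(1) x y(2,3)] .
  obtain \<beta>1 where \<beta>1: "\<beta>1 \<in> Hsupp b'' b" "\<phi> \<beta>1 x = y"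
    using orbit_intermediate_value[OF \<beta>(1) x y(2,4)] .
  note \<alpha>1H = Hsupp_carrier[OF \<alpha>1(1)] and \<beta>1H = Hsupp_carrier[OF \<beta>1(1)]
  \<comment> \<open>The element \<open>n\<close> fixes \<open>x\<close>, hence its orbit: \<open>\<alpha>1\<close> and \<open>\<beta>1\<close> act equally there.\<close>
  define n where "n = inv\<^bsub>Hplus\<^esub> \<beta>1 \<otimes>\<^bsub>Hplus\<^esub> \<alpha>1"
  have n: "n \<in> Hsupp 0 b" unfolding n_def
    by (rule Hsupp_mult[OF Hsupp_inv]) (use \<alpha>1 \<beta>1 sub in blast)+
  have n_act: "\<phi> n z = \<phi> (inv\<^bsub>Hplus\<^esub> \<beta>1) (\<phi> \<alpha>1 z)" if "z \<in> {0..1}" for z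
    unfolding n_def using act_mult[OF Hplus_inv_closed[OF \<beta>1H] \<alpha>1H that] .
  have nx: "\<phi> n x = x" using n_act[OF x] act_inv(1)[OF \<beta>1H x] \<alpha>1 \<beta>1 by simp
  have conj: "\<phi> (\<delta> \<otimes>\<^bsub>Hplus\<^esub> \<alpha>1 \<otimes>\<^bsub>Hplus\<^esub> inv\<^bsub>Hplus\<^esub> \<delta>) x = y" if \<delta>: "\<delta> \<in> Hsupp 0 b''" for \<delta>
  proof -
    note \<delta>H = Hsupp_carrier[OF \<delta>]
    let ?z = "\<phi> (inv\<^bsub>Hplus\<^esub> \<delta>) x"
    have z: "?z \<in> {0..1}" using act_mem[OF Hplus_inv_closed[OF \<delta>H] x] .
    have "\<phi> n ?z = ?z" using trivial[OF n nx, of "inv\<^bsub>Hplus\<^esub> \<delta>"] Hsupp_inv[OF \<delta>] sub by blast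
    then have "\<phi> \<beta>1 (\<phi> (inv\<^bsub>Hplus\<^esub> \<beta>1) (\<phi> \<alpha>1 ?z)) = \<phi> \<beta>1 ?z" using n_act[OF z] by simp
    then have 1: "\<phi> \<alpha>1 ?z = \<phi> \<beta>1 ?z" using act_inv(2)[OF \<beta>1H act_mem[OF \<alpha>1H z]] by simp
    have "\<phi> (\<delta> \<otimes>\<^bsub>Hplus\<^esub> \<alpha>1 \<otimes>\<^bsub>Hplus\<^esub> inv\<^bsub>Hplus\<^esub> \<delta>) x = \<phi> \<delta> (\<phi> \<alpha>1 ?z)"
      using act_mult[OF Hplus_mult_closed[OF \<delta>H \<alpha>1H] Hplus_inv_closed[OF \<delta>H] x]
        act_mult[OF \<delta>H \<alpha>1H z] by simp
    also have "\<dots> = \<phi> \<beta>1 (\<phi> \<delta> ?z)" using 1 act_commute[OF \<delta> \<beta>1(1)] b b' b'' z by simp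
    also have "\<dots> = y" using act_inv(2)[OF \<delta>H x] \<beta>1 by simp
    finally show ?thesis .
  qed
  have "\<alpha>1 \<in> Hsupp 0 b'" "0 < b'" "b'' \<le> 1" using \<alpha>1(1) sub b b' b'' by auto
  then obtain \<delta> where \<delta>: "\<And>n::nat. \<delta> n \<in> Hsupp 0 b''"
    and lim: "\<And>p. p \<in> {0..1} \<Longrightarrow> (\<lambda>n. (\<delta> n \<otimes>\<^bsub>Hplus\<^esub> \<alpha>1 \<otimes>\<^bsub>Hplus\<^esub> inv\<^bsub>Hplus\<^esub> \<delta> n) p) \<longlonglongrightarrow> p"
    using Hsupp_squeeze[OF _ _ b''(1)] by blast
  have "(\<lambda>n. \<phi> (\<delta> n \<otimes>\<^bsub>Hplus\<^esub> \<alpha>1 \<otimes>\<^bsub>Hplus\<^esub> inv\<^bsub>Hplus\<^esub> \<delta> n) x) \<longlonglongrightarrow> \<phi> \<one>\<^bsub>Hplus\<^esub> x"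
  proof (rule pointwise_continuous[OF _ Hplus_one_closed _ x])
    show "\<delta> n \<otimes>\<^bsub>Hplus\<^esub> \<alpha>1 \<otimes>\<^bsub>Hplus\<^esub> inv\<^bsub>Hplus\<^esub> \<delta> n \<in> Hplus_carrier" for n
      using Hsupp_carrier[OF \<delta>] \<alpha>1H by (simp add: Hplus_mult_closed Hplus_inv_closed)
  qed (simp add: one_Hplus_apply lim del: atLeastAtMost_iff)
  then have "y = x" using conj[OF \<delta>] act_one[OF x] by (simp add: LIMSEQ_const_iff)
  then show False using y by simp
qed

text \<open>By \<open>fixes_supp_left_or_right\<close> the intervals \<open>(0,b)\<close> whose homeomorphisms fix \<open>x\<close> and the intervals
  \<open>(b,1)\<close> with this property meet at a threshold \<open>q\<close>, and both one-sided groups at \<open>q\<close> fix \<open>x\<close> by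
  continuity. Together they generate the stabilizer of \<open>q\<close>.\<close>

lemma point_stabilizer_fixes:
  assumes x: "x \<in> {0..1}" and f0: "f0 \<in> Hplus_carrier" "\<phi> f0 x \<noteq> x"
  obtains q where "q \<in> {0<..<1}"
    and "\<And>f. \<lbrakk>f \<in> Hplus_carrier; f q = q\<rbrakk> \<Longrightarrow> \<phi> f x = x"
proof -
  have moved: "\<not> fixes_supp 0 1 x" using f0 by (auto simp: fixes_supp_def Hsupp_0_1)
  \<comment> \<open>The threshold is the supremum of \<open>Q\<close>; \<open>b0\<close> and \<open>b1\<close> keep it away from \<open>0\<close> and \<open>1\<close>.\<close>
  define Q where "Q = {b \<in> {0<..<1}. fixes_supp 0 b x}"
  have "\<exists>b\<in>{0<..<1}. \<not> fixes_supp b 1 x" using fixes_supp_limit_left[of 0 1 x] x moved by (meson order_refl zero_less_one)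
  then obtain b0 where b0: "b0 \<in> Q" using fixes_supp_left_or_right[OF _ x] unfolding Q_def by blast
  obtain b1 where b1: "b1 \<in> {0<..<1}" "\<not> fixes_supp 0 b1 x"
    using fixes_supp_limit_right[of 0 1 x] x moved by auto
  have mono: "fixes_supp 0 b x" if "fixes_supp 0 b' x" "b \<le> b'" for b b'
    using that Hsupp_mono[of 0 0 b b'] by (auto simp: fixes_supp_def)
  have Q_le: "b \<le> b1" if "b \<in> Q" for b
    using that b1 mono[of b b1] by (fastforce simp: Q_def)
  define q where "q = Sup Q"
  have bdd: "bdd_above Q" using Q_le by (rule bdd_above.I)
  have "b0 \<le> q" unfolding q_def using b0 bdd by (rule cSup_upper)
  moreover have "q \<le> b1" unfolding q_def using b0 Q_le by (intro cSup_least) auto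
  ultimately have q: "q \<in> {0<..<1}" using b0 b1 by (auto simp: Q_def)
  have left: "fixes_supp 0 q x"
  proof (rule fixes_supp_limit_right)
    fix c assume "c \<in> {0<..<q}"
    then obtain b where "b \<in> Q" "c < b" using less_cSupD[of Q c] b0 by (auto simp: q_def)
    then show "fixes_supp 0 c x" using mono by (auto simp: Q_def)
  qed (use q x in auto)
  have right: "fixes_supp q 1 x"
  proof (rule fixes_supp_limit_left)
    fix c assume c: "c \<in> {q<..<1}"
    then have "c \<notin> Q" using cSup_upper[OF _ bdd, of c] by (auto simp: q_def)
    then show "fixes_supp c 1 x" using fixes_supp_left_or_right[OF _ x, of c] c q by (auto simp: Q_def)
  qed (use q x in auto)
  show thesis
  proof (rule that[OF q])
    fix f assume f: "f \<in> Hplus_carrier" "f q = q"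
    \<comment> \<open>Split \<open>f\<close> at its fixed point \<open>q\<close> into a left and a right part.\<close>
    define f1 where "f1 = (\<lambda>p\<in>{0..1}. if p \<le> 0 \<or> q \<le> p then p else f p)"
    define f2 where "f2 = (\<lambda>p\<in>{0..1}. if p \<le> q \<or> 1 \<le> p then p else f p)"
    have mono_f: "strict_mono_on S f" if "S \<subseteq> {0..1}" for S
      using f(1) that unfolding Hplus_carrier_iff strict_mono_on_def by blast
    have cont_f: "continuous_on S f" if "S \<subseteq> {0..1}" for S
      using continuous_on_subset[OF Hplus_continuous[OF f(1)] that] .
    have f1: "f1 \<in> Hsupp 0 q" unfolding f1_def
      by (rule Hsupp_extendI[OF _ _ _ cont_f mono_f]) (use q f Hplus_0[OF f(1)] in auto)
    have f2: "f2 \<in> Hsupp q 1" unfolding f2_def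
      by (rule Hsupp_extendI[OF _ _ _ cont_f mono_f]) (use q f Hplus_1[OF f(1)] in auto)
    note H = Hsupp_carrier[OF f1] Hsupp_carrier[OF f2]
    have "f = f1 \<otimes>\<^bsub>Hplus\<^esub> f2"
    proof (rule Hplus_eqI[OF f(1) Hplus_mult_closed[OF H]])
      fix p :: real assume p: "p \<in> {0..1}"
      have 0: "f 0 = 0" "f 1 = 1" using f Hplus_0 Hplus_1 by auto
      show "f p = (f1 \<otimes>\<^bsub>Hplus\<^esub> f2) p"
      proof (cases "p \<le> q")
        case True
        then have "f2 p = p" using Hsupp_fix[OF f2 p] by simp
        moreover have "f1 p = f p" using True p 0 f(2) by (auto simp: f1_def)
        ultimately show ?thesis using mult_Hplus_apply[OF H p] by simp
      next
        case False
        then have "f q < f p" using Hplus_less_iff[OF f(1), of q p] p q by auto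
        then have "f1 (f p) = f p" using Hsupp_fix[OF f1 Hplus_mem[OF f(1) p]] f(2) by simp
        moreover have "f2 p = f p" using False p 0 by (auto simp: f2_def)
        ultimately show ?thesis using mult_Hplus_apply[OF H p] by simp
      qed
    qed
    then show "\<phi> f x = x"
      using act_mult[OF H x] fixes_suppD[OF left f1] fixes_suppD[OF right f2] by simp
  qed
qed

text \<open>Since the stabilizer of \<open>q\<close> fixes \<open>x\<close>, the rule \<open>f(q) \<mapsto> \<phi> f x\<close> defines a map \<open>h\<close>, which is
  equivariant. Because \<open>Hplus\<close> acts transitively on pairs \<open>y < z\<close> and every \<open>\<phi> f\<close> is increasing, the
  sign of \<open>h z - h y\<close> is the same for all such pairs. It is not zero because \<open>x\<close> is moved.
  A decreasing \<open>h\<close> does occur, for instance when \<open>\<phi>\<close> is conjugation by \<open>1 - p\<close>.\<close>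

lemma equivariant_monotone_map:
  assumes nontrivial: "f0 \<in> Hplus_carrier" "x \<in> {0..1}" "\<phi> f0 x \<noteq> x"
  obtains h where "\<And>y. y \<in> {0<..<1} \<Longrightarrow> h y \<in> {0..1}"
    and "\<And>f y. \<lbrakk>f \<in> Hplus_carrier; y \<in> {0<..<1}\<rbrakk> \<Longrightarrow> \<phi> f (h y) = h (f y)"
    and "strict_mono_on {0<..<1} h \<or> strict_antimono_on {0<..<1} h"
proof -
  note x = nontrivial(2)
  obtain q where q: "q \<in> {0<..<1}"
    and stab: "\<And>f. \<lbrakk>f \<in> Hplus_carrier; f q = q\<rbrakk> \<Longrightarrow> \<phi> f x = x"
    using point_stabilizer_fixes[OF x nontrivial(1,3)] by blast
  have "\<exists>d\<in>Hplus_carrier. d q = y" if y: "y \<in> {0<..<1}" for y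
  proof -
    obtain d where "d \<in> Hsupp 0 1" "d q = y" using Hsupp_transitive[of 0 1 q y] q y by auto
    then show ?thesis using Hsupp_carrier by blast
  qed
  then obtain t where t: "\<And>y. y \<in> {0<..<1} \<Longrightarrow> t y \<in> Hplus_carrier \<and> t y q = y" by metis
  define h where "h = (\<lambda>y. \<phi> (t y) x)"
  have q01: "q \<in> {0..1}" using q by auto
  have h: "h (f q) = \<phi> f x" if f: "f \<in> Hplus_carrier" for f
  proof -
    have fq: "f q \<in> {0<..<1}" using Hplus_mem_greaterThanLessThan[OF f q] .
    note tf = t[OF fq]
    have "\<phi> (inv\<^bsub>Hplus\<^esub> (t (f q)) \<otimes>\<^bsub>Hplus\<^esub> f) x = x"
    proof (rule stab)
      show "inv\<^bsub>Hplus\<^esub> t (f q) \<otimes>\<^bsub>Hplus\<^esub> f \<in> Hplus_carrier" using tf f by (simp add: Hplus_mult_closed Hplus_inv_closed)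
      show "(inv\<^bsub>Hplus\<^esub> t (f q) \<otimes>\<^bsub>Hplus\<^esub> f) q = q"
        using tf f q01 inv_Hplus_eqI[of "t (f q)" q "f q"] by (simp add: mult_Hplus_apply Hplus_inv_closed)
    qed
    then have "\<phi> (t (f q)) (\<phi> (inv\<^bsub>Hplus\<^esub> (t (f q))) (\<phi> f x)) = \<phi> (t (f q)) x"
      using act_mult[of "inv\<^bsub>Hplus\<^esub> (t (f q))" f x] tf f x by (simp add: Hplus_inv_closed)
    then show ?thesis using act_inv(2)[of "t (f q)"] tf act_mem[OF f x] by (simp add: h_def)
  qed
  have h_mem: "h y \<in> {0..1}" if "y \<in> {0<..<1}" for y
    using act_mem[OF _ x] t[OF that] by (simp add: h_def)
  have equiv: "\<phi> f (h y) = h (f y)" if f: "f \<in> Hplus_carrier" and y: "y \<in> {0<..<1}" for f y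
  proof -
    note ty = t[OF y]
    have "h ((f \<otimes>\<^bsub>Hplus\<^esub> t y) q) = \<phi> (f \<otimes>\<^bsub>Hplus\<^esub> t y) x" using h ty f Hplus_mult_closed by blast
    then show ?thesis using ty f q01 x by (simp add: mult_Hplus_apply act_mult h_def)
  qed
  have two_transitive: "\<exists>f\<in>Hplus_carrier. f y = y' \<and> f z = z'"
    if yz: "0 < y" "y < z" "z < 1" "0 < y'" "y' < z'" "z' < 1" for y z y' z'
  proof -
    obtain f where f: "f \<in> Hsupp 0 1" "f y = y'" using Hsupp_transitive[of 0 1 y y'] yz by auto
    note fH = Hsupp_carrier[OF f(1)]
    have "y' < f z" using Hplus_less_iff[OF fH, of y z] yz f by auto
    moreover have "f z < 1" using Hplus_less_iff[OF fH, of z 1] yz Hplus_1[OF fH] by auto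
    ultimately obtain g where g: "g \<in> Hsupp y' 1" "g (f z) = z'"
      using Hsupp_transitive[of y' 1 "f z" z'] yz by auto
    note gH = Hsupp_carrier[OF g(1)]
    have "g y' = y'" using Hsupp_fix[OF g(1), of y'] yz by auto
    then have "(g \<otimes>\<^bsub>Hplus\<^esub> f) y = y' \<and> (g \<otimes>\<^bsub>Hplus\<^esub> f) z = z'"
      using f g yz by (simp add: mult_Hplus_apply fH gH)
    then show ?thesis using Hplus_mult_closed[OF gH fH] by blast
  qed
  have transport: "(h y < h z \<longleftrightarrow> h y' < h z') \<and> (h z < h y \<longleftrightarrow> h z' < h y')"
    if yz: "0 < y" "y < z" "z < 1" "0 < y'" "y' < z'" "z' < 1" for y z y' z'
  proof -
    obtain f where f: "f \<in> Hplus_carrier" "f y = y'" "f z = z'" using two_transitive[OF yz] by blast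
    have m: "h y \<in> {0..1}" "h z \<in> {0..1}" using yz by (auto intro!: h_mem simp del: atLeastAtMost_iff)
    have "\<phi> f (h y) = h y'" "\<phi> f (h z) = h z'" using f equiv[OF f(1), of y] equiv[OF f(1), of z] yz by auto
    then show ?thesis using act_less_iff[OF f(1) m] act_less_iff[OF f(1) m(2,1)] by simp
  qed
  have f0q: "f0 q \<in> {0<..<1}" using Hplus_mem_greaterThanLessThan[OF nontrivial(1) q] .
  have one: "h q = x" using h[OF Hplus_one_closed] act_one[OF x] one_Hplus_apply[OF q01] by simp
  have ne: "h q \<noteq> h (f0 q)" using h[OF nontrivial(1)] nontrivial(3) one by simp
  then have "q \<noteq> f0 q" by auto
  then obtain y z where yz: "0 < y" "y < z" "z < 1" "h y \<noteq> h z"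
    using q f0q ne by (metis greaterThanLessThan_iff linorder_neqE)
  show thesis
  proof (rule that[OF h_mem equiv])
    show "strict_mono_on {0<..<1} h \<or> strict_antimono_on {0<..<1} h"
    proof (cases "h y < h z")
      case True
      then have "strict_mono_on {0<..<1} h"
        using transport[OF yz(1-3)] by (auto simp: strict_mono_on_def)
      then show ?thesis ..
    next
      case False
      then have "h z < h y" using yz by simp
      then have "strict_antimono_on {0<..<1} h"
        using transport[OF yz(1-3)] by (auto simp: monotone_on_def)
      then show ?thesis ..
    qed
  qed auto
qed

end

section \<open>Convergence, compact sets and compactly generated subgroups\<close>

abbreviation Hplus_mdist :: "(real \<Rightarrow> real) \<Rightarrow> (real \<Rightarrow> real) \<Rightarrow> real" where
  "Hplus_mdist \<equiv> mdist (cfunspace (top_of_set {0..1}) euclidean_metric)"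

interpretation Hplus_metric: Metric_space Hplus_carrier Hplus_mdist
  by (rule Metric_space.subspace[OF Metric_space_mspace_mdist Hplus_carrier_subset_cfunspace])

lemma mtopology_Hplus: "Hplus_metric.mtopology = Hplus_topology"
proof -
  let ?M = "cfunspace (top_of_set {0..1::real}) (euclidean_metric :: real metric)"
  have "Hplus_topology = mtopology_of (submetric ?M Hplus_carrier)"
    by (simp add: Hplus_topology_def mtopology_of_submetric)
  also have "\<dots> = Hplus_metric.mtopology"
    unfolding mtopology_of_def mdist_submetric mspace_submetric
    using Hplus_carrier_subset_cfunspace by (simp add: Int_absorb1 Int_absorb2 del: mspace_cfunspace)
  finally show ?thesis ..
qed

lemma Hplus_dist_bounds:
  assumes "f \<in> Hplus_carrier" "g \<in> Hplus_carrier"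
  shows "p \<in> {0..1} \<Longrightarrow> \<bar>f p - g p\<bar> \<le> Hplus_mdist f g"
    and "(\<And>p. p \<in> {0..1} \<Longrightarrow> \<bar>f p - g p\<bar> \<le> e) \<Longrightarrow> Hplus_mdist f g \<le> e"
proof -
  have eq: "Hplus_mdist f g = (SUP x\<in>{0..1}. \<bar>f x - g x\<bar>)"
    using Hplus_dist assms by simp
  have "\<bar>f p - g p\<bar> \<le> 1" if "p \<in> {0..1}" for p
    using Hplus_mem[OF assms(1) that] Hplus_mem[OF assms(2) that] by auto
  then have "bdd_above ((\<lambda>x. \<bar>f x - g x\<bar>) ` {0..1})" by (rule bdd_aboveI2)
  then show "p \<in> {0..1} \<Longrightarrow> \<bar>f p - g p\<bar> \<le> Hplus_mdist f g"
    unfolding eq by (intro cSUP_upper)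
  show "(\<And>p. p \<in> {0..1} \<Longrightarrow> \<bar>f p - g p\<bar> \<le> e) \<Longrightarrow> Hplus_mdist f g \<le> e"
    unfolding eq by (intro cSUP_least) auto
qed

lemma limitin_Hplus_uniform:
  assumes "limitin Hplus_topology F f sequentially" "\<And>n. F n \<in> Hplus_carrier" "e > 0"
  shows "\<forall>\<^sub>F n in sequentially. \<forall>p\<in>{0..1}. \<bar>F n p - f p\<bar> < e"
proof -
  have "f \<in> Hplus_carrier" "\<forall>\<^sub>F n in sequentially. Hplus_mdist (F n) f < e"
    using assms unfolding mtopology_Hplus[symmetric] Hplus_metric.limitin_metric
    by (auto simp: eventually_conj_iff)
  then show ?thesis
    using assms(2) Hplus_dist_bounds(1) by (auto elim!: eventually_mono) (meson atLeastAtMost_iff le_less_trans)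
qed

lemma limitin_Hplus_carrier: "limitin Hplus_topology F f sequentially \<Longrightarrow> f \<in> Hplus_carrier"
  using limitin_topspace by force

lemma limitin_Hplus_pointwise:
  assumes "limitin Hplus_topology F f sequentially" "\<And>n. F n \<in> Hplus_carrier" "p \<in> {0..1}"
  shows "(\<lambda>n. F n p) \<longlonglongrightarrow> f p"
proof (rule tendstoI)
  fix e :: real assume "e > 0"
  from limitin_Hplus_uniform[OF assms(1,2) this]
  show "\<forall>\<^sub>F n in sequentially. dist (F n p) (f p) < e"
    by eventually_elim (use assms(3) in \<open>simp add: dist_real_def\<close>)
qed

text \<open>Pointwise convergence of monotone functions to a continuous one is uniform (Polya): it is enough to
  control the values on a finite grid so fine that the limit varies little between grid points.\<close>

lemma pointwise_imp_limitin_Hplus: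
  assumes F: "\<And>n. F n \<in> Hplus_carrier" and f: "f \<in> Hplus_carrier"
    and lim: "\<And>p. p \<in> {0..1} \<Longrightarrow> (\<lambda>n. F n p) \<longlonglongrightarrow> f p"
  shows "limitin Hplus_topology F f sequentially"
  unfolding mtopology_Hplus[symmetric] Hplus_metric.limitin_metric
proof (intro conjI allI impI f)
  fix e :: real assume e: "e > 0"
  have "uniformly_continuous_on {0..1} f"
    by (rule compact_uniformly_continuous[OF Hplus_continuous[OF f]]) simp
  then obtain d where d: "d > 0" "\<And>x y. \<lbrakk>x \<in> {0..1}; y \<in> {0..1}; \<bar>y - x\<bar> < d\<rbrakk> \<Longrightarrow> \<bar>f y - f x\<bar> < e/4"
    unfolding uniformly_continuous_on_def dist_real_def using e
    by (metis zero_less_divide_iff zero_less_numeral)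
  obtain N :: nat where N: "N > 0" "1 / real N < d"
    using reals_Archimedean[OF d(1)] by (metis inverse_eq_divide zero_less_Suc)
  let ?P = "(\<lambda>i. real i / real N) ` {..N}"
  have P01: "x \<in> {0..1}" if "x \<in> ?P" for x using that N by auto
  have "\<forall>\<^sub>F n in sequentially. \<forall>x\<in>?P. \<bar>F n x - f x\<bar> < e/4"
  proof (rule eventually_ball_finite)
    show "\<forall>x\<in>?P. \<forall>\<^sub>F n in sequentially. \<bar>F n x - f x\<bar> < e/4"
    proof
      fix x assume "x \<in> ?P"
      then have "(\<lambda>n. F n x) \<longlonglongrightarrow> f x" using lim P01 by blast
      then show "\<forall>\<^sub>F n in sequentially. \<bar>F n x - f x\<bar> < e/4"
        using e unfolding tendsto_iff dist_real_def by (meson divide_pos_pos zero_less_numeral)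
    qed
  qed simp
  then show "\<forall>\<^sub>F n in sequentially. F n \<in> Hplus_carrier \<and> Hplus_mdist (F n) f < e"
  proof eventually_elim
    case (elim n)
    have "\<bar>F n p - f p\<bar> \<le> e/2" if p: "p \<in> {0..1}" for p
    proof (cases "p = 1")
      case True then show ?thesis using Hplus_1[OF F] Hplus_1[OF f] e by simp
    next
      case False
      define i where "i = nat \<lfloor>p * N\<rfloor>"
      have pN: "0 \<le> p * N" "p * N < N" using p False N by auto
      have "real i \<le> p * N" "p * N < real i + 1" "i < N"
        unfolding i_def using pN by (auto simp: nat_less_iff floor_less_iff)
      then have i: "real i / N \<le> p" "p < real (i+1) / N" "i+1 \<le> N"
        using N by (auto simp: field_simps)
      let ?a = "real i / N" and ?b = "real (i+1) / N"
      have ab: "?a \<in> ?P" "?b \<in> ?P" by (rule imageI; use i(3) in simp)+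
      have ba: "?b - ?a = 1 / real N" by (simp add: add_divide_distrib)
      have "F n ?a \<le> F n p" "F n p \<le> F n ?b"
        using Hplus_le_iff[OF F] P01[OF ab(1)] P01[OF ab(2)] p i by auto
      moreover have "\<bar>F n ?a - f ?a\<bar> < e/4" "\<bar>F n ?b - f ?b\<bar> < e/4" using elim ab by blast+
      moreover have "\<bar>f p - f ?a\<bar> < e/4" "\<bar>f p - f ?b\<bar> < e/4"
        using d(2)[OF P01[OF ab(1)] p] d(2)[OF P01[OF ab(2)] p] i ba N(2) by auto
      ultimately show ?thesis by linarith
    qed
    then have "Hplus_mdist (F n) f \<le> e/2" using Hplus_dist_bounds(2)[OF F f] by blast
    then show ?case using F e by auto
  qed
qed

text \<open>With \<open>z\<^sub>n = G\<^sub>n\<^sup>-\<^sup>1 p\<close>, uniform convergence gives \<open>g z\<^sub>n \<longlonglongrightarrow> p\<close>, so \<open>z\<^sub>n\<close> converges to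
  \<open>g\<^sup>-\<^sup>1 p\<close>; uniform convergence of \<open>F\<^sub>n\<close> handles the outer factor.\<close>

lemma limitin_Hplus_mult_inv:
  assumes F: "limitin Hplus_topology F f sequentially" "\<And>n. F n \<in> Hplus_carrier"
    and G: "limitin Hplus_topology G g sequentially" "\<And>n. G n \<in> Hplus_carrier"
  shows "limitin Hplus_topology (\<lambda>n. F n \<otimes>\<^bsub>Hplus\<^esub> inv\<^bsub>Hplus\<^esub> G n) (f \<otimes>\<^bsub>Hplus\<^esub> inv\<^bsub>Hplus\<^esub> g) sequentially"
proof (rule pointwise_imp_limitin_Hplus)
  have fH: "f \<in> Hplus_carrier" and gH: "g \<in> Hplus_carrier" using F G limitin_Hplus_carrier by auto
  show "F n \<otimes>\<^bsub>Hplus\<^esub> inv\<^bsub>Hplus\<^esub> G n \<in> Hplus_carrier" for n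
    using F G by (simp add: Hplus_mult_closed Hplus_inv_closed)
  show "f \<otimes>\<^bsub>Hplus\<^esub> inv\<^bsub>Hplus\<^esub> g \<in> Hplus_carrier"
    using fH gH by (simp add: Hplus_mult_closed Hplus_inv_closed)
  fix p :: real assume p: "p \<in> {0..1}"
  define z where "z = (\<lambda>n. (inv\<^bsub>Hplus\<^esub> G n) p)"
  define w where "w = (inv\<^bsub>Hplus\<^esub> g) p"
  have z01: "z n \<in> {0..1}" for n unfolding z_def using Hplus_mem[OF Hplus_inv_closed[OF G(2)] p] .
  have w01: "w \<in> {0..1}" unfolding w_def using Hplus_mem[OF Hplus_inv_closed[OF gH] p] .
  have Gz: "G n (z n) = p" for n unfolding z_def using inv_Hplus_apply(2)[OF G(2) p] .
  have "(\<lambda>n. g (z n)) \<longlonglongrightarrow> p"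
  proof (rule tendstoI)
    fix e :: real assume "e > 0"
    from limitin_Hplus_uniform[OF G this] show "\<forall>\<^sub>F n in sequentially. dist (g (z n)) p < e"
    proof eventually_elim
      case (elim n)
      then have "\<bar>G n (z n) - g (z n)\<bar> < e" using z01 by blast
      then show ?case using Gz[of n] by (simp add: dist_real_def abs_minus_commute)
    qed
  qed
  then have "(\<lambda>n. (inv\<^bsub>Hplus\<^esub> g) (g (z n))) \<longlonglongrightarrow> (inv\<^bsub>Hplus\<^esub> g) p"
    by (rule continuous_on_tendsto_compose[OF Hplus_continuous[OF Hplus_inv_closed[OF gH]]])
      (use p z01 Hplus_mem[OF gH] in auto)
  then have zw: "z \<longlonglongrightarrow> w" using inv_Hplus_apply(1)[OF gH z01] by (simp add: w_def)
  have "(\<lambda>n. F n (z n) - f (z n)) \<longlonglongrightarrow> 0"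
  proof (rule tendstoI)
    fix e :: real assume "e > 0"
    from limitin_Hplus_uniform[OF F this] show "\<forall>\<^sub>F n in sequentially. dist (F n (z n) - f (z n)) 0 < e"
      by eventually_elim (use z01 in \<open>simp add: dist_real_def\<close>)
  qed
  moreover have "(\<lambda>n. f (z n)) \<longlonglongrightarrow> f w"
    by (rule continuous_on_tendsto_compose[OF Hplus_continuous[OF fH] zw w01]) (use z01 in auto)
  ultimately have "(\<lambda>n. F n (z n) - f (z n) + f (z n)) \<longlonglongrightarrow> 0 + f w" by (rule tendsto_add)
  then show "(\<lambda>n. (F n \<otimes>\<^bsub>Hplus\<^esub> inv\<^bsub>Hplus\<^esub> G n) p) \<longlonglongrightarrow> (f \<otimes>\<^bsub>Hplus\<^esub> inv\<^bsub>Hplus\<^esub> g) p"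
    using p by (simp add: mult_Hplus_apply[OF F(2) Hplus_inv_closed[OF G(2)] p]
        mult_Hplus_apply[OF fH Hplus_inv_closed[OF gH] p] z_def w_def)
qed

lemma compactin_Hplus_iff:
  "compactin Hplus_topology S \<longleftrightarrow> S \<subseteq> Hplus_carrier \<and>
    (\<forall>\<sigma>::nat \<Rightarrow> _. range \<sigma> \<subseteq> S \<longrightarrow>
      (\<exists>l r. l \<in> S \<and> strict_mono r \<and> limitin Hplus_topology (\<sigma> \<circ> r) l sequentially))"
  using Hplus_metric.compactin_sequentially[of S] by (simp add: mtopology_Hplus)

lemma compactin_Hplus_mult_inv:
  assumes A: "compactin Hplus_topology A" and B: "compactin Hplus_topology B"
  shows "compactin Hplus_topology {a \<otimes>\<^bsub>Hplus\<^esub> inv\<^bsub>Hplus\<^esub> b |a b. a \<in> A \<and> b \<in> B}" (is "compactin _ ?S")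
  unfolding compactin_Hplus_iff
proof (intro conjI allI impI)
  have sub: "A \<subseteq> Hplus_carrier" "B \<subseteq> Hplus_carrier" using A B by (auto simp: compactin_Hplus_iff)
  then show "?S \<subseteq> Hplus_carrier" by (auto intro!: Hplus_mult_closed Hplus_inv_closed)
  fix \<sigma> :: "nat \<Rightarrow> _" assume "range \<sigma> \<subseteq> ?S"
  then have "\<forall>n. \<exists>a b. a \<in> A \<and> b \<in> B \<and> \<sigma> n = a \<otimes>\<^bsub>Hplus\<^esub> inv\<^bsub>Hplus\<^esub> b" by blast
  then obtain a b where ab: "\<And>n. a n \<in> A" "\<And>n. b n \<in> B" "\<And>n. \<sigma> n = a n \<otimes>\<^bsub>Hplus\<^esub> inv\<^bsub>Hplus\<^esub> b n"
    by metis
  obtain r l where r: "l \<in> A" "strict_mono r" "limitin Hplus_topology (a \<circ> r) l sequentially"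
    using A ab(1) unfolding compactin_Hplus_iff by (meson image_subset_iff)
  obtain s m where s: "m \<in> B" "strict_mono s" "limitin Hplus_topology (b \<circ> r \<circ> s) m sequentially"
    using B ab(2) unfolding compactin_Hplus_iff by (metis comp_apply image_subset_iff)
  have "limitin Hplus_topology (a \<circ> r \<circ> s) l sequentially"
    using limitin_subsequence[OF s(2) r(3)] .
  from limitin_Hplus_mult_inv[OF this _ s(3)]
  have "limitin Hplus_topology (\<sigma> \<circ> (r \<circ> s)) (l \<otimes>\<^bsub>Hplus\<^esub> inv\<^bsub>Hplus\<^esub> m) sequentially"
    using ab sub by (simp add: comp_def subset_iff)
  moreover have "l \<otimes>\<^bsub>Hplus\<^esub> inv\<^bsub>Hplus\<^esub> m \<in> ?S" using r s by blast
  ultimately show "\<exists>l r. l \<in> ?S \<and> strict_mono r \<and> limitin Hplus_topology (\<sigma> \<circ> r) l sequentially"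
    using strict_mono_o[OF r(2) s(2)] by blast
qed

text \<open>The easy half of the Arzela--Ascoli theorem.\<close>

lemma compactin_Hplus_equicontinuous:
  assumes K: "compactin Hplus_topology K" and e: "e > 0"
  shows "\<exists>d>0. \<forall>f\<in>K. \<forall>p\<in>{0..1}. \<forall>q\<in>{0..1}. \<bar>p - q\<bar> < d \<longrightarrow> \<bar>f p - f q\<bar> < e"
proof (rule ccontr)
  assume not: "\<not> ?thesis"
  have "\<exists>f p q. f \<in> K \<and> p \<in> {0..1} \<and> q \<in> {0..1} \<and> \<bar>p - q\<bar> < 1 / real (Suc n) \<and> e \<le> \<bar>f p - f q\<bar>" for n
  proof -
    have "1 / real (Suc n) > 0" by simp
    then show ?thesis using not by (meson not_le)
  qed
  then obtain \<sigma> p q where \<sigma>: "\<And>n. \<sigma> n \<in> K" and p: "\<And>n. p n \<in> {0..1}" and q: "\<And>n. q n \<in> {0..1}"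
    and close: "\<And>n. \<bar>p n - q n\<bar> < 1 / real (Suc n)" and far: "\<And>n. e \<le> \<bar>\<sigma> n (p n) - \<sigma> n (q n)\<bar>"
    by metis
  obtain r l where r: "l \<in> K" "strict_mono r" and lim: "limitin Hplus_topology (\<sigma> \<circ> r) l sequentially"
    using K \<sigma> unfolding compactin_Hplus_iff by (meson image_subset_iff)
  have KH: "K \<subseteq> Hplus_carrier" using K by (simp add: compactin_Hplus_iff)
  have "uniformly_continuous_on {0..1} l"
    by (rule compact_uniformly_continuous[OF Hplus_continuous]) (use r KH in auto)
  then obtain d where d: "d > 0" "\<And>x y. \<lbrakk>x \<in> {0..1}; y \<in> {0..1}; \<bar>y - x\<bar> < d\<rbrakk> \<Longrightarrow> \<bar>l y - l x\<bar> < e/3"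
    unfolding uniformly_continuous_on_def dist_real_def using e
    by (metis zero_less_divide_iff zero_less_numeral)
  have "(\<sigma> \<circ> r) n \<in> Hplus_carrier" for n using \<sigma> KH by auto
  from limitin_Hplus_uniform[OF lim this, of "e/3"]
  have "\<forall>\<^sub>F n in sequentially. \<forall>x\<in>{0..1}. \<bar>\<sigma> (r n) x - l x\<bar> < e/3" using e by simp
  moreover have "\<forall>\<^sub>F n in sequentially. 1 / real (Suc n) < d"
    using order_tendstoD(2)[OF LIMSEQ_Suc[OF lim_1_over_n] d(1)] by simp
  ultimately have "\<forall>\<^sub>F n in sequentially. False"
  proof eventually_elim
    case (elim n)
    have "n \<le> r n" using r(2) by (rule seq_suble)
    then have "1 / real (Suc (r n)) \<le> 1 / real (Suc n)" by (simp add: frac_le)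
    then have "\<bar>p (r n) - q (r n)\<bar> < d" using close[of "r n"] elim by linarith
    then have "\<bar>l (p (r n)) - l (q (r n))\<bar> < e/3" using d(2) p q by blast
    moreover have "\<bar>\<sigma> (r n) (p (r n)) - l (p (r n))\<bar> < e/3" "\<bar>\<sigma> (r n) (q (r n)) - l (q (r n))\<bar> < e/3"
      using elim p q by blast+
    ultimately show False using far[of "r n"] by linarith
  qed
  then show False by simp
qed

lemma K_sigma_in_exhaustion:
  assumes "K_sigma_in X S"
  obtains K :: "nat \<Rightarrow> 'a set" where "\<And>n. compactin X (K n)" "incseq K" "S = (\<Union>n. K n)"
proof -
  obtain U where U: "countable U" "\<And>A. A \<in> U \<Longrightarrow> compactin X A" "\<Union>U = S"
    using assms by (auto simp: K_sigma_in_def union_of_def)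
  \<comment> \<open>Adding the empty set makes the family nonempty, so that it can be enumerated by \<open>nat\<close>.\<close>
  define U' where "U' = insert {} U"
  have U': "countable U'" "U' \<noteq> {}" "\<And>A. A \<in> U' \<Longrightarrow> compactin X A" "\<Union>U' = S"
    using U by (auto simp: U'_def)
  define K where "K = (\<lambda>n. \<Union>i\<le>n. from_nat_into U' i)"
  show thesis
  proof
    show "compactin X (K n)" for n
      unfolding K_def by (rule compactin_Union) (use U'(3) from_nat_into[OF U'(2)] in auto)
    show "incseq K" unfolding K_def incseq_def by (intro allI impI UN_mono) auto
    have "(\<Union>n. K n) = \<Union>(range (from_nat_into U'))" by (auto simp: K_def)
    then show "S = (\<Union>n. K n)" using range_from_nat_into[OF U'(2,1)] U'(4) by simp
  qed
qed

text \<open>Closing a set that contains the identity repeatedly under \<open>(a,b) \<mapsto> a b\<^sup>-\<^sup>1\<close> exhausts the subgroup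
  that it generates: this one operation yields both products and inverses, and it preserves
  compactness.\<close>

primrec quotient_words :: "(real \<Rightarrow> real) set \<Rightarrow> nat \<Rightarrow> (real \<Rightarrow> real) set" where
  "quotient_words C 0 = C"
| "quotient_words C (Suc n) =
    {a \<otimes>\<^bsub>Hplus\<^esub> inv\<^bsub>Hplus\<^esub> b |a b. a \<in> quotient_words C n \<and> b \<in> quotient_words C n}"

lemma compactly_generated_subgroup:
  assumes C: "compactin Hplus_topology C" and one: "\<one>\<^bsub>Hplus\<^esub> \<in> C"
  defines "H \<equiv> \<Union>n. quotient_words C n"
  shows "subgroup H Hplus" "K_sigma_in Hplus_topology H" "C \<subseteq> H"
proof -
  let ?W = "quotient_words C"
  have comp: "compactin Hplus_topology (?W n)" for n
    by (induction n) (simp_all add: C compactin_Hplus_mult_inv)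
  have car: "?W n \<subseteq> Hplus_carrier" for n using comp by (simp add: compactin_Hplus_iff)
  have one_n: "\<one>\<^bsub>Hplus\<^esub> \<in> ?W n" for n
  proof (induction n)
    case (Suc n)
    have "\<one>\<^bsub>Hplus\<^esub> = \<one>\<^bsub>Hplus\<^esub> \<otimes>\<^bsub>Hplus\<^esub> inv\<^bsub>Hplus\<^esub> \<one>\<^bsub>Hplus\<^esub>"
      using Hplus_one_closed by simp
    then show ?case using Suc unfolding quotient_words.simps by blast
  qed (simp add: one)
  have "?W n \<subseteq> ?W (Suc n)" for n
  proof
    fix a assume a: "a \<in> ?W n"
    then have "a \<in> Hplus_carrier" using car by blast
    then have "a = a \<otimes>\<^bsub>Hplus\<^esub> inv\<^bsub>Hplus\<^esub> \<one>\<^bsub>Hplus\<^esub>" by simp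
    then show "a \<in> ?W (Suc n)" using a one_n unfolding quotient_words.simps by blast
  qed
  then have inc: "incseq ?W" by (rule incseq_SucI)
  have diff: "a \<otimes>\<^bsub>Hplus\<^esub> inv\<^bsub>Hplus\<^esub> b \<in> H" if ab: "a \<in> H" "b \<in> H" for a b
  proof -
    obtain i j where "a \<in> ?W i" "b \<in> ?W j" using ab by (auto simp: H_def)
    then have "a \<in> ?W (max i j)" "b \<in> ?W (max i j)" 
      using incseqD[OF inc max.cobounded1] incseqD[OF inc max.cobounded2] by blast+
    then have "a \<otimes>\<^bsub>Hplus\<^esub> inv\<^bsub>Hplus\<^esub> b \<in> ?W (Suc (max i j))" by auto
    then show ?thesis unfolding H_def by blast
  qed
  have HH: "H \<subseteq> Hplus_carrier" using car by (auto simp: H_def)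
  have oneH: "\<one>\<^bsub>Hplus\<^esub> \<in> H" using one_n by (auto simp: H_def)
  show "subgroup H Hplus"
  proof (rule Hp.subgroupI)
    show "H \<subseteq> carrier Hplus" "H \<noteq> {}" using HH oneH by auto
    show inv: "inv\<^bsub>Hplus\<^esub> a \<in> H" if "a \<in> H" for a
      using diff[OF oneH that] that HH by (auto simp: Hplus_inv_closed)
    show "a \<otimes>\<^bsub>Hplus\<^esub> b \<in> H" if "a \<in> H" "b \<in> H" for a b
      using diff[OF that(1) inv[OF that(2)]] that HH by (auto simp: subset_iff)
  qed
  show "K_sigma_in Hplus_topology H"
    unfolding K_sigma_in_def union_of_def
    by (rule exI[of _ "range ?W"]) (use comp in \<open>auto simp: H_def\<close>)
  have "?W 0 \<subseteq> H" unfolding H_def by blast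
  then show "C \<subseteq> H" by simp
qed


section \<open>Slides and steep homeomorphisms\<close>

lemma Baire_interval:
  fixes a b :: real
  assumes ab: "a < b" and closed: "\<And>n::nat. closed (S n)" and cover: "{a..b} \<subseteq> (\<Union>n. S n)"
  obtains n c d where "a \<le> c" "c < d" "d \<le> b" "{c..d} \<subseteq> S n"
proof -
  let ?X = "top_of_set {a..b}"
  have "\<exists>n. ?X interior_of ({a..b} \<inter> S n) \<noteq> {}"
  proof (rule ccontr)
    assume "\<not> ?thesis"
    then have "?X interior_of \<Union>(range (\<lambda>n. {a..b} \<inter> S n)) = {}"
      by (intro Baire_category_alt disjI2 conjI regular_space_subtopology regular_space_euclidean
          compact_imp_locally_compact_space compact_space_subtopology)
        (auto simp: closedin_closed_Int closed)
    moreover have "\<Union>(range (\<lambda>n. {a..b} \<inter> S n)) = topspace ?X" using cover by auto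
    ultimately have "topspace ?X = {}" by (metis interior_of_topspace)
    then show False using ab by simp
  qed
  then obtain n x where "x \<in> ?X interior_of ({a..b} \<inter> S n)" by blast
  then obtain U where U: "openin ?X U" "x \<in> U" "U \<subseteq> {a..b} \<inter> S n" by (auto simp: interior_of_def)
  then obtain V where V: "open V" "U = {a..b} \<inter> V" by (auto simp: openin_open)
  then have "x \<in> V" using U by blast
  then obtain e where e: "e > 0" "cball x e \<subseteq> V" using V(1) open_contains_cball by blast
  have x: "a \<le> x" "x \<le> b" using U by auto
  show thesis
  proof
    show "{max a (x - e)..min b (x + e)} \<subseteq> S n"
      using U V e by (auto simp: cball_eq_atLeastAtMost subset_iff)
  qed (use x e ab in auto)
qed

text \<open>Translation by \<open>s\<close> on \<open>[3/8,5/8]\<close>, damped to the identity outside \<open>[1/8,7/8]\<close>. The damping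
  factor has slope at most \<open>4\<close>, so for \<open>\<bar>s\<bar> \<le> 1/8\<close> the map is still strictly increasing.\<close>

definition slide :: "real \<Rightarrow> real \<Rightarrow> real" where
  "slide s = (\<lambda>p\<in>{0..1}. p + s * max 0 (min 1 (min (4 * (p - 1/8)) (4 * (7/8 - p)))))"

lemma abs_le_eighth_iff: "\<bar>s\<bar> \<le> 1/8 \<longleftrightarrow> s \<in> {-(1/8)..1/8::real}"
  by auto

lemma slide_apply: "\<lbrakk>3/8 \<le> p; p \<le> 5/8\<rbrakk> \<Longrightarrow> slide s p = p + s"
  by (simp add: slide_def min_def max_def)

lemma slide_Hsupp:
  assumes s: "\<bar>s\<bar> \<le> 1/8"
  shows "slide s \<in> Hsupp (1/8) (7/8)"
proof -
  define b :: "real \<Rightarrow> real" where "b p = max 0 (min 1 (min (4 * (p - 1/8)) (4 * (7/8 - p))))" for p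
  have lip: "\<bar>b p - b q\<bar> \<le> 4 * (q - p)" if "p < q" for p q
    using that by (simp add: b_def max_def min_def abs_if)
  have eq: "slide s = restrict (\<lambda>p. p + s * b p) {0..1}" by (simp add: slide_def b_def)
  have "slide s \<in> Hplus_carrier"
    unfolding eq
  proof (rule Hplus_restrictI)
    show "continuous_on {0..1} (\<lambda>p. p + s * b p)"
      unfolding b_def by (intro continuous_intros)
    show "strict_mono_on {0..1} (\<lambda>p. p + s * b p)"
    proof (rule strict_mono_onI)
      fix p q :: real assume "p < q"
      have "\<bar>s * (b p - b q)\<bar> \<le> 1/8 * (4 * (q - p))"
        unfolding abs_mult using s lip[OF \<open>p < q\<close>] \<open>p < q\<close> by (intro mult_mono) auto
      then have "\<bar>s * b p - s * b q\<bar> < q - p" using \<open>p < q\<close> by (simp add: right_diff_distrib)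
      then show "p + s * b p < q + s * b q" by linarith
    qed
  qed (simp_all add: b_def)
  then show ?thesis by (auto simp: Hsupp_def slide_def min_def max_def)
qed

lemma compactin_slides: "compactin Hplus_topology (slide ` {- (1/8)..1/8})"
  unfolding compactin_Hplus_iff
proof (intro conjI allI impI)
  have car: "slide s \<in> Hplus_carrier" if "s \<in> {- (1/8)..1/8}" for s
    using slide_Hsupp that Hsupp_carrier unfolding abs_le_eighth_iff by blast
  then show "slide ` {- (1/8)..1/8} \<subseteq> Hplus_carrier" by blast
  fix \<sigma> :: "nat \<Rightarrow> real \<Rightarrow> real" assume "range \<sigma> \<subseteq> slide ` {- (1/8)..1/8}"
  then have "\<forall>n. \<exists>s. s \<in> {- (1/8)..1/8} \<and> \<sigma> n = slide s" by blast
  then obtain s where s: "\<And>n. s n \<in> {- (1/8)..1/8}" "\<And>n. \<sigma> n = slide (s n)" by metis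
  have "seq_compact {- (1/8)..1/8::real}" by (simp add: compact_imp_seq_compact)
  then obtain l r where r: "l \<in> {- (1/8)..1/8}" "strict_mono r" "(s \<circ> r) \<longlonglongrightarrow> l"
    using s(1) unfolding seq_compact_def by blast
  have "limitin Hplus_topology (\<sigma> \<circ> r) (slide l) sequentially"
  proof (rule pointwise_imp_limitin_Hplus)
    show "(\<lambda>n. (\<sigma> \<circ> r) n p) \<longlonglongrightarrow> slide l p" if "p \<in> {0..1}" for p
      using r(3) that by (auto simp: s slide_def comp_def intro!: tendsto_intros)
  qed (use s r car in auto)
  then show "\<exists>f r. f \<in> slide ` {- (1/8)..1/8} \<and> strict_mono r \<and> limitin Hplus_topology (\<sigma> \<circ> r) f sequentially"
    using r by blast
qed

text \<open>The infimum over \<open>j\<close> of the functions that have the value \<open>t j\<close> up to \<open>v j\<close> and then rise with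
  slope \<open>8\<close>, capped at \<open>1\<close>. It is Lipschitz and monotone as each of them is. It is positive at every
  \<open>x > 0\<close> because only finitely many of the \<open>v j\<close> exceed \<open>x/2\<close>.\<close>

lemma flat_modulus:
  fixes t v :: "nat \<Rightarrow> real"
  assumes t: "\<And>j. t j > 0" and v: "\<And>j. v j \<le> 1/8" "v \<longlonglongrightarrow> 0"
  shows "\<exists>u :: real \<Rightarrow> real. continuous_on UNIV u \<and> mono u \<and> (\<forall>x>0. u x > 0) \<and>
    u (1/4) = 1 \<and> (\<forall>j. u (v j) \<le> t j)"
proof -
  define f where "f = (\<lambda>x j. min 1 (t j + 8 * max 0 (x - v j)))"
  define u where "u = (\<lambda>x. INF j. f x j)"
  have bdd: "bdd_below (range (f x))" for x
    by (rule bdd_belowI2[of _ 0]) (use less_imp_le[OF t] in \<open>auto simp: f_def intro!: add_nonneg_nonneg\<close>)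
  have le: "u x \<le> f x j" for x j unfolding u_def by (rule cINF_lower[OF bdd]) simp
  have ge: "c \<le> u x" if "\<And>j. c \<le> f x j" for c x unfolding u_def by (rule cINF_greatest) (use that in auto)
  have mono: "u x \<le> u y" if "x \<le> y" for x y
  proof (rule ge)
    fix j
    have "f x j \<le> f y j" using that by (auto simp: f_def min_def max_def)
    then show "u x \<le> f y j" using le[of x j] by linarith
  qed
  then have u_mono: "mono u" by (simp add: mono_def)
  have lip: "u y \<le> u x + 8 * (y - x)" if "x \<le> y" for x y
  proof -
    have "u y - 8 * (y - x) \<le> u x"
    proof (rule ge)
      fix j
      have "f y j \<le> f x j + 8 * (y - x)" using that by (auto simp: f_def min_def max_def)
      then show "u y - 8 * (y - x) \<le> f x j" using le[of y j] by linarith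
    qed
    then show ?thesis by linarith
  qed
  have "8-lipschitz_on UNIV u"
  proof (rule lipschitz_onI)
    fix x y :: real
    show "dist (u x) (u y) \<le> 8 * dist x y"
      using lip[of x y] lip[of y x] mono[of x y] mono[of y x] by (auto simp: dist_real_def abs_if)
  qed simp
  then have u_cont: "continuous_on UNIV u" by (rule lipschitz_on_continuous_on)
  have u_pos: "u x > 0" if x: "x > 0" for x
  proof -
    have "\<forall>\<^sub>F j in sequentially. v j < x/2" by (rule order_tendstoD(2)[OF v(2)]) (use x in simp)
    then obtain J where J: "\<And>j. j \<ge> J \<Longrightarrow> v j < x/2" by (auto simp: eventually_sequentially)
    define m where "m = Min ((\<lambda>j. min 1 (t j)) ` {..J})"
    have "m \<in> (\<lambda>j. min 1 (t j)) ` {..J}" unfolding m_def by (rule Min_in) auto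
    then have m: "m > 0" using t by auto
    have "min m (min 1 (4 * x)) \<le> f x j" for j
    proof (cases "j \<le> J")
      case True
      then have "m \<le> min 1 (t j)" unfolding m_def by (intro Min_le) auto
      also have "\<dots> \<le> f x j" by (auto simp: f_def min_def max_def)
      finally show ?thesis by simp
    next
      case False
      then have "v j < x/2" using J by simp
      then have "min 1 (4 * x) \<le> f x j" using t[of j] by (auto simp: f_def min_def max_def)
      then show ?thesis by simp
    qed
    then have "min m (min 1 (4 * x)) \<le> u x" by (rule ge)
    then show ?thesis using m x by (auto simp: min_def split: if_splits)
  qed
  have u_1: "u (1/4) = 1"
  proof -
    have "f (1/4) j = 1" for j using v(1)[of j] t[of j] by (auto simp: f_def min_def max_def)
    then show ?thesis by (simp add: u_def)
  qed
  have "u (v j) \<le> t j" for j using le[of "v j" j] by (auto simp: f_def)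
  then show ?thesis using u_mono u_cont u_pos u_1 by blast
qed

text \<open>The inverse of \<open>1/2 + x \<mapsto> 1/2 + x u(x)\<close>, with \<open>u\<close> as in \<open>flat_modulus\<close>. The factor \<open>x\<close> makes
  the map strictly increasing although \<open>u\<close> may have plateaus.\<close>

lemma steep_homeomorphism:
  fixes t v :: "nat \<Rightarrow> real"
  assumes t: "\<And>j. t j > 0" "\<And>j. t j \<le> 1/8" and v: "\<And>j. v j > 0" "\<And>j. v j \<le> 1/8" "v \<longlonglongrightarrow> 0"
  shows "\<exists>g\<in>Hsupp (1/2) (3/4). \<forall>j. 1/2 + v j \<le> g (1/2 + t j)"
proof -
  have "\<exists>u :: real \<Rightarrow> real. continuous_on UNIV u \<and> mono u \<and> (\<forall>x>0. u x > 0) \<and>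
    u (1/4) = 1 \<and> (\<forall>j. u (v j) \<le> t j)"
    by (rule flat_modulus[OF t(1) v(2,3)])
  then obtain u :: "real \<Rightarrow> real" where u: "continuous_on UNIV u" "mono u" "\<And>x. x > 0 \<Longrightarrow> u x > 0"
    "u (1/4) = 1" "\<And>j. u (v j) \<le> t j"
    by blast
  define F where "F = (\<lambda>x. 1/2 + (x - 1/2) * u (x - 1/2))"
  define f where "f = (\<lambda>x\<in>{0..1}. if x \<le> 1/2 \<or> 3/4 \<le> x then x else F x)"
  have f: "f \<in> Hsupp (1/2) (3/4)"
    unfolding f_def
  proof (rule Hsupp_extendI)
    show "continuous_on {1/2..3/4} F"
      unfolding F_def by (intro continuous_intros continuous_on_compose2[OF u(1)]) auto
    show "strict_mono_on {1/2..3/4} F"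
    proof (rule strict_mono_onI)
      fix x y :: real assume xy: "x \<in> {1/2..3/4}" "y \<in> {1/2..3/4}" "x < y"
      have "(x - 1/2) * u (x - 1/2) \<le> (x - 1/2) * u (y - 1/2)"
        using xy monoD[OF u(2), of "x - 1/2" "y - 1/2"] by (intro mult_left_mono) auto
      also have "\<dots> < (y - 1/2) * u (y - 1/2)"
        using xy u(3)[of "y - 1/2"] by (intro mult_strict_right_mono) auto
      finally show "F x < F y" by (simp add: F_def)
    qed
  qed (use u(4) in \<open>auto simp: F_def\<close>)
  note fH = Hsupp_carrier[OF f]
  show ?thesis
  proof (intro bexI[OF _ Hsupp_inv[OF f]] allI)
    fix j
    have 1: "f (1/2 + v j) \<le> 1/2 + t j"
    proof -
      have "f (1/2 + v j) = 1/2 + v j * u (v j)" using v(1)[of j] v(2)[of j] by (simp add: f_def F_def)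
      also have "v j * u (v j) \<le> 1 * u (v j)"
        using v(1)[of j] v(2)[of j] u(3)[of "v j"] by (intro mult_right_mono) auto
      also have "1 * u (v j) \<le> t j" using u(5) by simp
      finally show ?thesis by simp
    qed
    have in01: "1/2 + v j \<in> {0..1}" "1/2 + t j \<in> {0..1}" using v(1)[of j] v(2)[of j] t[of j] by auto
    have "(inv\<^bsub>Hplus\<^esub> f) (f (1/2 + v j)) \<le> (inv\<^bsub>Hplus\<^esub> f) (1/2 + t j)"
      using Hplus_le_iff[OF Hplus_inv_closed[OF fH] Hplus_mem[OF fH in01(1)] in01(2)] 1 by simp
    then show "1/2 + v j \<le> (inv\<^bsub>Hplus\<^esub> f) (1/2 + t j)" using inv_Hplus_apply(1)[OF fH in01(1)] by simp
  qed
qed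

section \<open>Diagonalization against a compact exhaustion\<close>

lemma exists_small_increment:
  fixes f :: "nat \<Rightarrow> real"
  assumes "f N - f 0 < real N * D"
  shows "\<exists>i<N. f (Suc i) - f i < D"
proof (rule ccontr)
  assume "\<not> ?thesis"
  then have "of_nat (card {..<N}) * D \<le> (\<Sum>i<N. f (Suc i) - f i)"
    by (intro sum_bounded_below) (auto simp: not_less dest: leD)
  then show False using assms by (simp add: sum_lessThan_telescope)
qed

lemma total_increment_le:
  fixes f :: "nat \<Rightarrow> real"
  assumes "\<And>i. i < N \<Longrightarrow> f (Suc i) - f i \<le> e"
  shows "f N - f 0 \<le> real N * e"
  using sum_bounded_above[of "{..<N}" "\<lambda>i. f (Suc i) - f i" e] assms by (simp add: sum_lessThan_telescope)

text \<open>Here \<open>md n\<close> is a common modulus of continuity for \<open>K n\<close>. At stage \<open>j\<close> the lengths are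
  \<open>v = 1/(8(j+1))\<close> and \<open>t = v / N j\<close>, and \<open>g\<close> stretches the interval \<open>[1/2, 1/2 + t]\<close> over
  \<open>[1/2, 1/2 + v]\<close>. Among the \<open>N j\<close> consecutive intervals of length \<open>t\<close> right of \<open>1/2\<close>, there
  is one over which \<open>h\<close> varies by at most \<open>1 / N j\<close>. A slide transports this to the point \<open>1/2 + d\<close>, then \<open>g\<close>
  composed with the inverse of a slide transports it to the interval \<open>[1/2, 1/2 + v]\<close>, and slides
  again transport it to all intervals of length \<open>v\<close> that start in \<open>[1/2 + c, 1/2 + d]\<close>. Each
  transport costs one application of \<open>md j\<close>, whence the threefold iteration. All increments of \<open>h\<close>
  over length \<open>v\<close> are thus below \<open>1/(j+1)\<^sup>2\<close>, while \<open>O(j)\<close> of them cover \<open>[1/2 + c, 1/2 + d]\<close>. For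
  large \<open>j\<close> this contradicts \<open>h (1/2 + c) \<noteq> h (1/2 + d)\<close>.\<close>

lemma (in Hplus_action) not_captured_by_compacts:
  fixes K :: "nat \<Rightarrow> (real \<Rightarrow> real) set" and md :: "nat \<Rightarrow> real \<Rightarrow> real" and N :: "nat \<Rightarrow> nat"
  assumes K: "\<And>n. compactin Hplus_topology (K n)" "incseq K"
    and md_pos: "\<And>n e. e > 0 \<Longrightarrow> md n e > 0"
    and md: "\<And>n e f p q. \<lbrakk>e > 0; f \<in> K n; p \<in> {0..1}; q \<in> {0..1}; \<bar>p - q\<bar> < md n e\<rbrakk> \<Longrightarrow> \<bar>f p - f q\<bar> < e"
    and N: "\<And>j. N j > 0" "\<And>j. 1 < real (N j) * md j (md j (md j (1 / (real j + 1)^2)))"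
    and g: "g \<in> Hsupp (1/2) (3/4)"
      "\<And>j. 1/2 + 1 / (8 * (real j + 1)) \<le> g (1/2 + 1 / (8 * (real j + 1) * real (N j)))"
    and slides: "\<And>s. \<bar>s\<bar> \<le> 1/8 \<Longrightarrow> \<phi> (slide s) \<in> (\<Union>n. K n)"
    and steep: "\<And>s. \<bar>s\<bar> \<le> 1/8 \<Longrightarrow> \<phi> (g \<otimes>\<^bsub>Hplus\<^esub> inv\<^bsub>Hplus\<^esub> slide s) \<in> (\<Union>n. K n)"
    and nontrivial: "f0 \<in> Hplus_carrier" "x \<in> {0..1}" "\<phi> f0 x \<noteq> x"
  shows False
proof -
  obtain h where h_mem: "\<And>y. y \<in> {0<..<1} \<Longrightarrow> h y \<in> {0..1}"
    and equiv: "\<And>f y. \<lbrakk>f \<in> Hplus_carrier; y \<in> {0<..<1}\<rbrakk> \<Longrightarrow> \<phi> f (h y) = h (f y)"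
    and h_mono: "strict_mono_on {0<..<1} h \<or> strict_antimono_on {0<..<1} h"
    using equivariant_monotone_map[OF nontrivial] by blast
  \<comment> \<open>Changing the sign of \<open>h\<close> if necessary reduces to the increasing case.\<close>
  have "\<exists>\<sigma>::real. \<bar>\<sigma>\<bar> = 1 \<and> strict_mono_on {0<..<1} (\<lambda>y. \<sigma> * h y)"
  proof (cases "strict_mono_on {0<..<1} h")
    case True then show ?thesis by (intro exI[of _ 1]) simp
  next
    case False
    then have "strict_antimono_on {0<..<1} h" using h_mono by blast
    then show ?thesis by (intro exI[of _ "-1"]) (auto simp: monotone_on_def)
  qed
  then obtain \<sigma> :: real where \<sigma>: "\<bar>\<sigma>\<bar> = 1" and "strict_mono_on {0<..<1} (\<lambda>y. \<sigma> * h y)" by blast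
  define k where "k = (\<lambda>y. \<sigma> * h y)"
  have k_mono: "strict_mono_on {0<..<1} k" unfolding k_def by fact
  have k_le: "k y \<le> k z" if "0 < y" "y \<le> z" "z < 1" for y z
    using strict_mono_on_leD[OF k_mono, of y z] that by auto
  have kh: "\<bar>h z - h y\<bar> = k z - k y" if "0 < y" "y \<le> z" "z < 1" for y z
  proof -
    have "\<bar>h z - h y\<bar> = \<bar>\<sigma> * (h z - h y)\<bar>" using \<sigma> by (simp add: abs_mult)
    also have "\<dots> = \<bar>k z - k y\<bar>" by (simp add: k_def right_diff_distrib)
    finally show ?thesis using k_le[OF that] by simp
  qed
  have k_total: "k z - k y \<le> 1" if "0 < y" "y \<le> z" "z < 1" for y z
    using kh[OF that] h_mem[of y] h_mem[of z] that by (auto simp: abs_if split: if_splits)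
  have transport: "k (f z) - k (f y) < e"
    if "e > 0" "f \<in> Hplus_carrier" "\<phi> f \<in> K j" "0 < y" "y \<le> z" "z < 1" "k z - k y < md j e" for e f j y z
  proof -
    have yz: "y \<in> {0<..<1}" "z \<in> {0<..<1}" using that by auto
    have "\<bar>\<phi> f (h z) - \<phi> f (h y)\<bar> < e"
      using md[OF that(1,3) h_mem[OF yz(2)] h_mem[OF yz(1)]] kh[OF that(4-6)] that(7) by simp
    moreover have "f y \<le> f z" using Hplus_le_iff[OF that(2), of y z] that by auto
    ultimately show ?thesis
      using kh[of "f y" "f z"] equiv[OF that(2) yz(1)] equiv[OF that(2) yz(2)]
        Hplus_mem_greaterThanLessThan[OF that(2) yz(1)] Hplus_mem_greaterThanLessThan[OF that(2) yz(2)]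
      by auto
  qed
  have slideH: "slide s \<in> Hplus_carrier" if "\<bar>s\<bar> \<le> 1/8" for s using slide_Hsupp[OF that] Hsupp_carrier by blast
  define S where "S = (\<lambda>n. {s \<in> {-(1/8)..1/8}. \<phi> (slide s) \<in> K n})"
  have "closed (S n)" for n
    unfolding closed_sequential_limits
  proof (intro allI impI, elim conjE)
    fix s l assume s: "\<forall>i. s i \<in> S n" and lim: "s \<longlonglongrightarrow> l"
    have s8: "\<bar>s i\<bar> \<le> 1/8" for i using s unfolding S_def abs_le_eighth_iff by blast
    have l: "l \<in> {-(1/8)..1/8}"
      by (rule closed_sequentially[OF closed_atLeastAtMost _ lim]) (use s in \<open>simp add: S_def\<close>)
    then have l8: "\<bar>l\<bar> \<le> 1/8" unfolding abs_le_eighth_iff .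
    have "limitin Hplus_topology (\<lambda>i. \<phi> (slide (s i))) (\<phi> (slide l)) sequentially"
    proof (rule pointwise_imp_limitin_Hplus)
      show "\<phi> (slide (s i)) \<in> Hplus_carrier" for i by (rule act_closed[OF slideH[OF s8]])
      show "\<phi> (slide l) \<in> Hplus_carrier" by (rule act_closed[OF slideH[OF l8]])
      fix p :: real assume p: "p \<in> {0..1}"
      show "(\<lambda>i. \<phi> (slide (s i)) p) \<longlonglongrightarrow> \<phi> (slide l) p"
      proof (rule pointwise_continuous[OF slideH[OF s8] slideH[OF l8] _ p])
        show "(\<lambda>i. slide (s i) q) \<longlonglongrightarrow> slide l q" if "q \<in> {0..1}" for q
          using lim that by (auto simp: slide_def intro!: tendsto_intros)
      qed
    qed
    moreover have "closedin Hplus_topology (K n)"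
      using compactin_imp_closedin[OF Hplus_metric.Hausdorff_space_mtopology] K(1) mtopology_Hplus by metis
    ultimately have "\<phi> (slide l) \<in> K n"
      by (rule limitin_closedin) (use s in \<open>auto simp: S_def\<close>)
    then show "l \<in> S n" using l by (simp add: S_def)
  qed
  moreover have "{-(1/8)..1/8} \<subseteq> (\<Union>n. S n)" using slides unfolding S_def abs_le_eighth_iff by blast
  ultimately obtain n0 c d where cd: "-(1/8) \<le> c" "c < d" "d \<le> 1/8" "{c..d} \<subseteq> S n0"
    using Baire_interval[of "-(1/8)" "1/8" S] by (metis divide_pos_pos less_numeral_extra(1) neg_less_pos zero_less_numeral)
  have d8: "\<bar>d\<bar> \<le> 1/8" using cd by auto
  obtain m where m: "\<phi> (g \<otimes>\<^bsub>Hplus\<^esub> inv\<^bsub>Hplus\<^esub> slide d) \<in> K m" using steep[OF d8] by blast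
  define \<kappa> where "\<kappa> = k (1/2 + d) - k (1/2 + c)"
  have \<kappa>: "\<kappa> > 0" unfolding \<kappa>_def using strict_mono_onD[OF k_mono, of "1/2 + c" "1/2 + d"] cd by simp
  \<comment> \<open>\<open>i1\<close> ensures \<open>v \<le> d - c\<close>, and \<open>i2\<close> the final inequality \<open>3 / (j + 1) < \<kappa>\<close>.\<close>
  obtain i1 :: nat where i1: "1 / (d - c) < real i1" using reals_Archimedean2 by blast
  obtain i2 :: nat where i2: "3 / \<kappa> < real i2" using reals_Archimedean2 by blast
  define j where "j = n0 + m + i1 + i2"
  have Kj: "K n0 \<subseteq> K j" "K m \<subseteq> K j" using K(2) by (auto simp: j_def incseq_def)
  have slide_Kj: "\<phi> (slide s) \<in> K j" if "c \<le> s" "s \<le> d" for s using cd(4) that Kj by (auto simp: S_def)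
  define v where "v = 1 / (8 * (real j + 1))"
  define t where "t = 1 / (8 * (real j + 1) * real (N j))"
  define e where "e = 1 / (real j + 1)^2"
  have v: "0 < v" "v \<le> 1/8" by (auto simp: v_def field_simps)
  have Nt: "real (N j) * t = v" using N(1)[of j] by (simp add: t_def v_def)
  have t: "0 < t" "t \<le> v"
  proof -
    show "0 < t" using N(1)[of j] by (simp add: t_def)
    then have "1 * t \<le> real (N j) * t" using N(1)[of j] by (intro mult_right_mono) auto
    then show "t \<le> v" using Nt by simp
  qed
  have v_cd: "v \<le> d - c"
  proof -
    have "1 / (d - c) < 8 * (real j + 1)" using i1 by (simp add: j_def)
    then show ?thesis using cd(2) by (simp add: v_def field_simps)
  qed
  have e: "e > 0" by (simp add: e_def)
  note pos = md_pos[OF e] md_pos[OF md_pos[OF e]] md_pos[OF md_pos[OF md_pos[OF e]]]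
  define y where "y = (\<lambda>i. 1/2 + real i * t)"
  have y_bound: "y i \<le> 1/2 + v" if "i \<le> N j" for i
  proof -
    have "real i * t \<le> real (N j) * t" using that t by (intro mult_right_mono) auto
    then show ?thesis using Nt by (simp add: y_def)
  qed
  have "k (y (N j)) - k (y 0) \<le> 1" using k_total[of "y 0" "y (N j)"] Nt v by (simp add: y_def)
  then have "k (y (N j)) - k (y 0) < real (N j) * md j (md j (md j e))" using N(2)[of j] by (simp add: e_def)
  then obtain i where i: "i < N j" "k (y (Suc i)) - k (y i) < md j (md j (md j e))"
    using exists_small_increment[of "\<lambda>i. k (y i)"] by blast
  have yi: "1/2 \<le> y i" "y i \<le> 1/2 + v" "y (Suc i) \<le> 1/2 + v" "y (Suc i) = y i + t"
    using y_bound[of i] y_bound[of "Suc i"] i(1) t by (auto simp: y_def algebra_simps)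
  have step2: "k (1/2 + d + t) - k (1/2 + d) < md j (md j e)"
  proof -
    define s where "s = 1/2 + d - y i"
    have s: "c \<le> s" "s \<le> d" using yi v_cd by (auto simp: s_def)
    then have s8: "\<bar>s\<bar> \<le> 1/8" using cd by auto
    have "k (slide s (y (Suc i))) - k (slide s (y i)) < md j (md j e)"
      by (rule transport[OF pos(2) slideH[OF s8] slide_Kj[OF s]]) (use yi t v i in auto)
    moreover have "slide s (y (Suc i)) = 1/2 + d + t" "slide s (y i) = 1/2 + d"
      using yi v t by (auto simp: slide_apply s_def)
    ultimately show ?thesis by simp
  qed
  have step3: "k (1/2 + v) - k (1/2) < md j e"
  proof -
    define f where "f = g \<otimes>\<^bsub>Hplus\<^esub> inv\<^bsub>Hplus\<^esub> slide d"
    note gH = Hsupp_carrier[OF g(1)]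
    have fH: "f \<in> Hplus_carrier" unfolding f_def using gH slideH[OF d8] by (simp add: Hplus_mult_closed Hplus_inv_closed)
    have f_val: "f (p + d) = g p" if "3/8 \<le> p" "p \<le> 5/8" for p
    proof -
      have "slide d p = p + d" using slide_apply that by simp
      then have "(inv\<^bsub>Hplus\<^esub> slide d) (p + d) = p"
        using inv_Hplus_eqI[OF slideH[OF d8], of p] that by simp
      moreover have "p + d \<in> {0..1}" using that cd by auto
      ultimately show ?thesis
        unfolding f_def using mult_Hplus_apply[OF gH Hplus_inv_closed[OF slideH[OF d8]]] by simp
    qed
    have "k (f (1/2 + d + t)) - k (f (1/2 + d)) < md j e"
      by (rule transport[OF pos(1) fH _ _ _ _ step2]) (use m Kj cd t v in \<open>auto simp: f_def\<close>)
    moreover have "f (1/2 + d + t) = g (1/2 + t)" using f_val[of "1/2 + t"] t v by (simp add: algebra_simps)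
    moreover have "f (1/2 + d) = 1/2" using f_val[of "1/2"] Hsupp_fix[OF g(1), of "1/2"] by simp
    moreover have "k (1/2 + v) \<le> k (g (1/2 + t))"
    proof (rule k_le)
      show "1/2 + v \<le> g (1/2 + t)" using g(2)[of j] by (simp only: v_def t_def)
      show "g (1/2 + t) < 1" using Hplus_mem_greaterThanLessThan[OF gH, of "1/2 + t"] v t by auto
    qed (use v in simp)
    ultimately show ?thesis by simp
  qed
  have step4: "k (1/2 + s + v) - k (1/2 + s) < e" if s: "c \<le> s" "s \<le> d" for s
  proof -
    have s8: "\<bar>s\<bar> \<le> 1/8" using s cd by auto
    have "k (slide s (1/2 + v)) - k (slide s (1/2)) < e"
      by (rule transport[OF e slideH[OF s8] slide_Kj[OF s] _ _ _ step3]) (use v in auto)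
    then show ?thesis using v by (simp add: slide_apply add_ac)
  qed
  define M where "M = Suc (nat \<lfloor>(d - c) / v\<rfloor>)"
  have q: "(d - c) / v \<ge> 0" using cd v by simp
  have M: "real M \<le> (d - c) / v + 1" "(d - c) / v < real M" unfolding M_def using q by linarith+
  have Mv: "d - c < real M * v" "real M * v \<le> d - c + v"
    using M v by (auto simp: field_simps)
  define z where "z = (\<lambda>i. 1/2 + c + real i * v)"
  have "k (z M) - k (z 0) \<le> real M * e"
  proof (rule total_increment_le)
    fix i assume "i < M"
    then have "real i \<le> (d - c) / v" unfolding M_def using q by linarith
    then have "c + real i * v \<le> d" using v by (simp add: field_simps)
    moreover have "0 \<le> real i * v" using v by simp
    ultimately have "k (1/2 + (c + real i * v) + v) - k (1/2 + (c + real i * v)) < e"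
      by (intro step4) auto
    then show "k (z (Suc i)) - k (z i) \<le> e" by (simp add: z_def algebra_simps)
  qed
  moreover have "k (1/2 + d) \<le> k (z M)" using k_le[of "1/2 + d" "z M"] Mv cd v by (simp add: z_def)
  ultimately have "\<kappa> \<le> real M * e" by (simp add: \<kappa>_def z_def)
  also have "\<dots> \<le> (2 * (real j + 1) + 1) * e"
  proof (rule mult_right_mono)
    have "(d - c) / v \<le> (1/4) / v" using cd v by (intro divide_right_mono) auto
    also have "\<dots> = 2 * (real j + 1)" by (simp add: v_def)
    finally show "real M \<le> 2 * (real j + 1) + 1" using M by linarith
  qed (use e in simp)
  also have "\<dots> \<le> (3 * (real j + 1)) * e" using e by (intro mult_right_mono) auto
  also have "\<dots> = 3 / (real j + 1)"
  proof -
    have "(3 * x) * (1 / x^2) = 3 / x" for x :: real by (simp add: power2_eq_square)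
    then show ?thesis unfolding e_def .
  qed
  also have "\<dots> < \<kappa>"
  proof -
    have "3 / \<kappa> < real j + 1" using i2 by (simp add: j_def)
    then show ?thesis using \<kappa> by (simp add: field_simps)
  qed
  finally show False by simp
qed

theorem theorem1p2:
  shows "\<not> (\<exists>L. universal_K_sigma_subgroup Hplus Hplus_topology L)"
proof
  assume "\<exists>L. universal_K_sigma_subgroup Hplus Hplus_topology L"
  then obtain L where L: "K_sigma_in Hplus_topology L"
    and universal: "\<And>H. \<lbrakk>subgroup H Hplus; K_sigma_in Hplus_topology H\<rbrakk> \<Longrightarrow>
      group_hom_reducible Hplus Hplus_topology H L"
    by (auto simp: universal_K_sigma_subgroup_def)
  obtain K where K: "\<And>n. compactin Hplus_topology (K n)" "incseq K" "L = (\<Union>n. K n)"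
    using K_sigma_in_exhaustion[OF L] by blast
  define modulus where "modulus n e d \<longleftrightarrow>
      (\<forall>f\<in>K n. \<forall>p\<in>{0..1}. \<forall>q\<in>{0..1}. \<bar>p - q\<bar> < d \<longrightarrow> \<bar>f p - f q\<bar> < e)" for n e d
  have "\<exists>d>0. e > 0 \<longrightarrow> modulus n e d" for n e
  proof (cases "e > 0")
    case True
    then show ?thesis
      using compactin_Hplus_equicontinuous[OF K(1)[of n]] unfolding modulus_def by blast
  next
    case False then show ?thesis by (intro exI[of _ 1]) simp
  qed
  then have "\<forall>n e. \<exists>d. d > 0 \<and> (e > 0 \<longrightarrow> modulus n e d)" by blast
  then obtain md where "\<forall>n e. md n e > 0 \<and> (e > 0 \<longrightarrow> modulus n e (md n e))"
    unfolding choice_iff by blast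
  then have md_pos: "\<And>n e. md n e > 0" and md: "\<And>n e. e > 0 \<Longrightarrow> modulus n e (md n e)"
    by blast+
  \<comment> \<open>Everything up to \<open>g\<close> depends on \<open>L\<close> only; this is the diagonalization against all moduli of \<open>L\<close>.\<close>
  have "\<exists>N. N > 0 \<and> 1 < real N * md j (md j (md j (1 / (real j + 1)^2)))" for j
  proof -
    let ?D = "md j (md j (md j (1 / (real j + 1)^2)))"
    obtain N :: nat where N: "1 / ?D < real N" using reals_Archimedean2 by blast
    then have "0 < real N" using md_pos by (meson divide_pos_pos less_trans zero_less_one)
    then show ?thesis using N md_pos by (intro exI[of _ N]) (simp add: field_simps)
  qed
  then obtain N where N: "\<And>j. N j > 0" "\<And>j. 1 < real (N j) * md j (md j (md j (1 / (real j + 1)^2)))"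
    by metis
  have v_lim: "(\<lambda>j. 1 / (8 * (real j + 1))) \<longlonglongrightarrow> 0"
    using tendsto_mult_left[OF LIMSEQ_Suc[OF lim_1_over_n], of "1/8"] by (simp add: add_ac)
  have t_pos: "1 / (8 * (real j + 1) * real (N j)) > 0" for j using N(1)[of j] by simp
  have t_le: "1 / (8 * (real j + 1) * real (N j)) \<le> 1/8" for j
  proof -
    have "1 * 1 \<le> (real j + 1) * real (N j)" using N(1)[of j] by (intro mult_mono) auto
    then show ?thesis by (simp add: field_simps)
  qed
  have "\<exists>g\<in>Hsupp (1/2) (3/4).
      \<forall>j. 1/2 + 1 / (8 * (real j + 1)) \<le> g (1/2 + 1 / (8 * (real j + 1) * real (N j)))"
    by (rule steep_homeomorphism[OF t_pos t_le _ _ v_lim]) (auto simp: field_simps)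
  then obtain g where g: "g \<in> Hsupp (1/2) (3/4)"
      "\<And>j. 1/2 + 1 / (8 * (real j + 1)) \<le> g (1/2 + 1 / (8 * (real j + 1) * real (N j)))"
    by blast
  define C where "C = slide ` {-(1/8)..1/8} \<union> {\<one>\<^bsub>Hplus\<^esub>, g}"
  define H where "H = (\<Union>n. quotient_words C n)"
  have "compactin Hplus_topology C"
    unfolding C_def by (rule compactin_Un[OF compactin_slides finite_imp_compactin])
      (auto simp: Hplus_one_closed Hsupp_carrier[OF g(1)])
  from compactly_generated_subgroup[OF this]
  have H: "subgroup H Hplus" "K_sigma_in Hplus_topology H" "C \<subseteq> H" by (auto simp: H_def C_def)
  \<comment> \<open>The common fixed point \<open>1/8\<close> shows that \<open>H\<close> is a proper subgroup, so that \<open>\<phi>\<close> is nontrivial.\<close>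
  have C_fix: "C \<subseteq> {f \<in> Hplus_carrier. f (1/8) = 1/8}"
  proof
    fix f assume "f \<in> C"
    then consider s where "s \<in> {-(1/8)..1/8}" "f = slide s" | "f = \<one>\<^bsub>Hplus\<^esub>" | "f = g" by (auto simp: C_def)
    then have "f \<in> Hsupp (1/8) 1"
    proof cases
      case 1
      then have "f \<in> Hsupp (1/8) (7/8)" using slide_Hsupp[of s] unfolding abs_le_eighth_iff by blast
      then show ?thesis using Hsupp_mono[of "1/8" "1/8" "7/8" 1] by auto
    next
      case 3 then show ?thesis using g(1) Hsupp_mono[of "1/8" "1/2" "3/4" 1] by auto
    qed (simp add: Hsupp_one)
    then show "f \<in> {f \<in> Hplus_carrier. f (1/8) = 1/8}" using Hsupp_carrier Hsupp_fix[of f "1/8" 1 "1/8"] by auto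
  qed
  have "quotient_words C n \<subseteq> {f \<in> Hplus_carrier. f (1/8) = 1/8}" for n
  proof (induction n)
    case (Suc n)
    show ?case
    proof
      fix f assume "f \<in> quotient_words C (Suc n)"
      then obtain a b where f: "f = a \<otimes>\<^bsub>Hplus\<^esub> inv\<^bsub>Hplus\<^esub> b" and ab: "a \<in> Hplus_carrier" "a (1/8) = 1/8"
          "b \<in> Hplus_carrier" "b (1/8) = 1/8"
        using Suc by auto
      have "(inv\<^bsub>Hplus\<^esub> b) (1/8) = 1/8" by (rule inv_Hplus_eqI[OF ab(3) _ ab(4)]) simp
      moreover have "f (1/8) = a ((inv\<^bsub>Hplus\<^esub> b) (1/8))"
        unfolding f by (rule mult_Hplus_apply[OF ab(1) Hplus_inv_closed[OF ab(3)]]) simp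
      ultimately have "f (1/8) = 1/8" using ab(2) by metis
      moreover have "f \<in> Hplus_carrier" unfolding f by (rule Hplus_mult_closed[OF ab(1) Hplus_inv_closed[OF ab(3)]])
      ultimately show "f \<in> {f \<in> Hplus_carrier. f (1/8) = 1/8}" by blast
    qed
  next
    case 0
    show ?case unfolding quotient_words.simps by (rule C_fix)
  qed
  then have H_fix: "f (1/8) = 1/8" if "f \<in> H" for f using that unfolding H_def by blast
  obtain \<phi> where hom: "\<phi> \<in> hom Hplus Hplus" and cont: "continuous_map Hplus_topology Hplus_topology \<phi>"
    and H_eq: "H = {f \<in> Hplus_carrier. \<phi> f \<in> L}"
    using universal[OF H(1,2)] by (auto simp: group_hom_reducible_def)
  interpret Hplus_action \<phi>
  proof
    show "\<phi> \<in> hom Hplus Hplus" by (rule hom)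
    fix F :: "nat \<Rightarrow> real \<Rightarrow> real" and f x
    assume F: "\<And>n. F n \<in> Hplus_carrier" and f: "f \<in> Hplus_carrier"
      and lim: "\<And>p. p \<in> {0..1} \<Longrightarrow> (\<lambda>n. F n p) \<longlonglongrightarrow> f p" and x: "x \<in> {0..1::real}"
    have "limitin Hplus_topology (\<phi> \<circ> F) (\<phi> f) sequentially"
      by (rule continuous_map_limit[OF cont pointwise_imp_limitin_Hplus[OF F f lim]])
    moreover have "(\<phi> \<circ> F) n \<in> Hplus_carrier" for n using hom F by (auto simp: hom_def)
    ultimately show "(\<lambda>n. \<phi> (F n) x) \<longlonglongrightarrow> \<phi> f x"
      using limitin_Hplus_pointwise[of "\<phi> \<circ> F" "\<phi> f" x] x by simp
  qed
  obtain f0 where f0: "f0 \<in> Hsupp 0 1" "f0 (1/8) = 1/4"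
    using Hsupp_transitive[of 0 1 "1/8" "1/4"] by auto
  note f0H = Hsupp_carrier[OF f0(1)]
  have oneL: "\<phi> \<one>\<^bsub>Hplus\<^esub> \<in> L" using H(3) H_eq by (auto simp: C_def)
  have "\<exists>x\<in>{0..1}. \<phi> f0 x \<noteq> x"
  proof (rule ccontr)
    assume "\<not> ?thesis"
    then have "\<phi> f0 = \<phi> \<one>\<^bsub>Hplus\<^esub>"
      by (intro Hplus_eqI act_closed f0H Hplus_one_closed) (simp add: act_one)
    then have "f0 \<in> H" using oneL H_eq f0H by simp
    then show False using H_fix f0 by force
  qed
  then obtain x where x: "x \<in> {0..1}" "\<phi> f0 x \<noteq> x" by blast
  have slide_C: "slide s \<in> C" if "\<bar>s\<bar> \<le> 1/8" for s using that unfolding C_def abs_le_eighth_iff by blast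
  have img: "\<phi> f \<in> (\<Union>n. K n)" if "f \<in> H" for f using that H_eq K(3) by auto
  show False
  proof (rule not_captured_by_compacts[where K = K and md = md and N = N and g = g and x = x])
    show "\<bar>f p - f q\<bar> < e" if "e > 0" "f \<in> K n" "p \<in> {0..1}" "q \<in> {0..1}" "\<bar>p - q\<bar> < md n e" for n e f p q
      using md[OF that(1)] that unfolding modulus_def by blast
    show "\<phi> (slide s) \<in> (\<Union>n. K n)" if "\<bar>s\<bar> \<le> 1/8" for s
      using img slide_C[OF that] H(3) by blast
    show "\<phi> (g \<otimes>\<^bsub>Hplus\<^esub> inv\<^bsub>Hplus\<^esub> slide s) \<in> (\<Union>n. K n)" if "\<bar>s\<bar> \<le> 1/8" for s
    proof (rule img)
      have "g \<in> H" "slide s \<in> H" using slide_C[OF that] H(3) by (auto simp: C_def)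
      then show "g \<otimes>\<^bsub>Hplus\<^esub> inv\<^bsub>Hplus\<^esub> slide s \<in> H"
        using H(1) by (simp add: subgroup.m_closed subgroup.m_inv_closed)
    qed
  qed (rule K N g f0H x md_pos)+
qed

end
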